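(* Let $X$ be a Hilbert space and let $V$ be a closed convex body in $X$ (not necessarily bounded) with $S=\partial V$ a $C^1$ submanifold, so that the outer unit normal $N_S:S\to S_X$ is well defined. Let $L>0$. The following statements are equivalent: (1) $N_S$ is $L$-Lipschitz. (2) For every $0<r<1/L$ and every $x\in S$ there exists a closed ball $B(z,r)\subseteq V$ with $\partial B(z,r)\cap S=\{x\}$. (3) $\langle N_S(y),y-x\rangle\ge \tfrac{1}{2L}\|N_S(x)-N_S(y)\|^2$ for all $x,y\in S$. (4) There exists a convex function $F:X\to\mathbb{R}$ of class $C^{1,1}$ with $\operatorname{lip}(\nabla F)\le L$, $S=F^{-1}(1)$ and $\nabla F(x)=N_S(x)$ for every $x\in S$. Furthermore, if $V$ is bounded and $0\in\operatorname{int}(V)$, then the following statement is equivalent to the existence of some $L>0$ for which (1)–(4) hold: (5) for every $\alpha>0$, the Minkowski functional $\mu_V$ is of class $C^{1,1}$ on the set $\{x\in X:\mu_V(x)\ge\alpha\}$, i.e. $\mu_V$ is differentiable there and $\nabla\mu_V$ is Lipschitz on that set.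
   Context: A convex body is a closed convex set with nonempty interior (possibly unbounded). A function $F:X\to\mathbb{R}$ is of class $C^{1,1}$ if it is differentiable and $\nabla F$ is globally Lipschitz; $\operatorname{lip}(\cdot)$ denotes the Lipschitz constant. For $0\in\operatorname{int}(V)$, the Minkowski functional is $\mu_V(x)=\inf\{t>0: x/t\in V\}$. *)

theory Defs
  imports "HOL-Analysis.Analysis"
begin

definition c1_hypersurface :: "'a::real_normed_vector set \<Rightarrow> bool" where
  "c1_hypersurface S \<longleftrightarrow>
     (\<forall>x\<in>S. \<exists>U g (g' :: 'a \<Rightarrow> ('a \<Rightarrow>\<^sub>L real)).
        open U \<and> x \<in> U \<and>
        (\<forall>y\<in>U. (g has_derivative blinfun_apply (g' y)) (at y)) \<and>
        continuous_on U g' \<and> (\<forall>y\<in>U. g' y \<noteq> 0) \<and>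
        S \<inter> U = {y\<in>U. g y = 0})"

text \<open>Outer unit normal of the convex set V at a boundary point x: the unit
vector n with <n, y - x> \<le> 0 for all y in V (unique when the boundary is C^1).\<close>
definition outer_normal :: "'a::real_inner set \<Rightarrow> 'a \<Rightarrow> 'a" where
  "outer_normal V x = (THE n. norm n = 1 \<and> (\<forall>y\<in>V. inner n (y - x) \<le> 0))"

definition minkowski_functional :: "'a::real_normed_vector set \<Rightarrow> 'a \<Rightarrow> real" where
  "minkowski_functional V x = Inf {t. t > 0 \<and> scaleR (inverse t) x \<in> V}"

end

theory Submission
  imports Defs
begin

text \<open>
  The heart of the matter is that an \<open>L\<close>-Lipschitz normal \<open>N\<close> forces the ball of radius \<open>1/L\<close>
  touching the boundary at \<open>x\<close> from inside to stay in \<open>V\<close>. If the distance \<open>d\<close> from its centre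
  \<open>z = x - r N(x)\<close>, \<open>r = 1/L\<close>, to the boundary were less than \<open>r\<close> and attained at \<open>y\<close>, then
  \<open>z = y - d N(y)\<close>, and the Lipschitz bound on \<open>|N(x) - N(y)|\<close> contradicts \<open>\<langle>N(y), x - y\<rangle> \<le> 0\<close>;
  almost closest points suffice in infinite dimension. Supporting this ball at \<open>y\<close> is inequality
  (3). For (4) take \<open>F = 1 + L/2 (dist(\<cdot>, C)\<^sup>2 - r\<^sup>2)\<close>, where \<open>C\<close> is the inner parallel body of the
  centres of balls of radius \<open>r\<close> contained in \<open>V\<close>. For (5) put
  \<open>G(x) = N(s) / \<langle>N(s), s\<rangle>\<close> with \<open>s = x / \<mu>(x)\<close>; then
  \<open>\<langle>G(x), y - x\<rangle> \<le> \<mu>(y) - \<mu>(x) \<le> \<langle>G(y), y - x\<rangle>\<close>, so \<open>G\<close> is the gradient of \<open>\<mu>\<close> once it is Lipschitz.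
\<close>

section \<open>Interior points of convex sets\<close>

lemma convex_interior_shrink:
  fixes V :: "'a::real_normed_vector set"
  assumes "convex V" "c \<in> interior V" "x \<in> V" "0 < e" "e \<le> 1"
  shows "x + e *\<^sub>R (c - x) \<in> interior V"
proof -
  obtain d where d: "d > 0" "ball c d \<subseteq> V"
    using assms(2) mem_interior by blast
  have "ball (x + e *\<^sub>R (c - x)) (e * d) \<subseteq> V"
  proof
    fix y assume "y \<in> ball (x + e *\<^sub>R (c - x)) (e * d)"
    then have y: "norm (y - (x + e *\<^sub>R (c - x))) < e * d"
      by (simp add: dist_norm norm_minus_commute)
    \<comment> \<open>The homothety with centre \<open>x\<close> and ratio \<open>e\<close> maps
      \<open>ball c d\<close> onto the small ball; \<open>q\<close> is the preimage of
      \<open>y\<close> under it, so \<open>y\<close> is a convex combination of \<open>x\<close> and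
      \<open>q\<close>.\<close>
    define q where "q = c + (1/e) *\<^sub>R (y - (x + e *\<^sub>R (c - x)))"
    have "norm (q - c) = norm (y - (x + e *\<^sub>R (c - x))) / e"
      using \<open>0 < e\<close> by (simp add: q_def)
    then have "norm (q - c) < d"
      using y \<open>0 < e\<close> by (simp add: divide_less_eq mult.commute)
    then have "q \<in> V"
      using d by (auto simp: dist_norm norm_minus_commute)
    moreover have "y = (1 - e) *\<^sub>R x + e *\<^sub>R q"
      using \<open>0 < e\<close> by (simp add: q_def algebra_simps)
    ultimately show "y \<in> V"
      using assms convexD_alt[of V x q e] by simp
  qed
  then show ?thesis
    using d(1) \<open>0 < e\<close> mem_interior by (metis mult_pos_pos)
qed

section \<open>Projections in Hilbert spaces\<close>

text \<open>The almost closest points form a decreasing sequence of nonempty closed sets whose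
  diameters shrink to 0 by the parallelogram law. Completeness gives a common point; it minimises
  the distance, and minimality over a convex set yields the variational inequality.\<close>

lemma hilbert_closest_point_exists:
  fixes C :: "'a::{real_inner, complete_space} set"
  assumes "closed C" "convex C" "C \<noteq> {}"
  shows "\<exists>p\<in>C. \<forall>y\<in>C. inner (x - p) (y - p) \<le> 0"
proof -
  define d where "d = infdist x C"
  define S where "S n = C \<inter> cball x (d + 1 / real (Suc n))" for n
  have d0: "d \<ge> 0" by (simp add: d_def infdist_nonneg)
  have dle: "d \<le> norm (x - y)" if "y \<in> C" for y
    using infdist_le[OF that, of x] by (simp add: d_def dist_norm)
  have ne: "S n \<noteq> {}" for n
  proof -
    have "(INF a\<in>C. dist x a) < d + 1 / real (Suc n)"
      using assms(3) by (simp add: d_def infdist_notempty)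
    then obtain a where "a \<in> C" "dist x a < d + 1 / real (Suc n)"
      using assms(3) by (subst (asm) cINF_less_iff) auto
    then show ?thesis by (auto simp: S_def)
  qed
  have diam: "(norm (y - z))\<^sup>2 \<le> 4 * (2 * d + 1) / real (Suc n)"
    if y: "y \<in> S n" and z: "z \<in> S n" for y z n
  proof -
    define e where "e = 1 / real (Suc n)"
    have e: "0 < e" "e \<le> 1" by (auto simp: e_def)
    have "(1/2) *\<^sub>R y + (1/2) *\<^sub>R z \<in> C"
      using y z assms(2) by (intro convexD) (auto simp: S_def)
    then have "d\<^sup>2 \<le> (norm (x - ((1/2) *\<^sub>R y + (1/2) *\<^sub>R z)))\<^sup>2"
      using dle d0 by (intro power_mono) auto
    moreover have "(norm (x - y))\<^sup>2 \<le> (d + e)\<^sup>2" "(norm (x - z))\<^sup>2 \<le> (d + e)\<^sup>2"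
      using y z by (auto simp: S_def dist_norm e_def intro!: power_mono)
    \<comment> \<open>This is the parallelogram law for \<open>x - y\<close> and
      \<open>x - z\<close>; the midpoint of \<open>y\<close> and \<open>z\<close> lies in
      \<open>C\<close>, hence is at distance at least \<open>d\<close> from
      \<open>x\<close>.\<close>
    moreover have "(norm (y - z))\<^sup>2 = 2 * (norm (x - y))\<^sup>2 + 2 * (norm (x - z))\<^sup>2
        - 4 * (norm (x - ((1/2) *\<^sub>R y + (1/2) *\<^sub>R z)))\<^sup>2"
    proof -
      define u v where "u = x - y" and "v = x - z"
      have "x - ((1/2) *\<^sub>R y + (1/2) *\<^sub>R z) = (1/2) *\<^sub>R (u + v)"
        using scaleR_half_double[of x] by (simp add: u_def v_def algebra_simps)
      moreover have "y - z = v - u" by (simp add: u_def v_def)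
      ultimately show ?thesis
        by (simp add: power2_norm_eq_inner inner_diff_left inner_diff_right inner_add_left
            inner_add_right inner_commute power_divide add_divide_distrib flip: u_def v_def)
    qed
    ultimately have "(norm (y - z))\<^sup>2 \<le> 4 * (d + e)\<^sup>2 - 4 * d\<^sup>2"
      by linarith
    also have "\<dots> = 4 * (2 * d + e) * e"
      by (simp add: power2_eq_square algebra_simps)
    also have "\<dots> \<le> 4 * (2 * d + 1) * e"
      using e by (intro mult_right_mono) auto
    finally show ?thesis by (simp add: e_def)
  qed
  have small: "\<exists>n. \<forall>y\<in>S n. \<forall>z\<in>S n. dist y z < e" if "e > 0" for e
  proof -
    obtain n where n: "4 * (2 * d + 1) / e\<^sup>2 < real n"
      using reals_Archimedean2 by blast
    have "4 * (2 * d + 1) / real (Suc n) < e\<^sup>2"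
    proof -
      have "4 * (2 * d + 1) < real n * e\<^sup>2"
        using n that by (simp add: divide_less_eq)
      also have "\<dots> \<le> real (Suc n) * e\<^sup>2"
        by (intro mult_right_mono) auto
      finally show ?thesis by (simp add: divide_less_eq mult.commute)
    qed
    then have "norm (y - z) < e" if "y \<in> S n" "z \<in> S n" for y z
      using diam[OF that] \<open>e > 0\<close> by (intro power_less_imp_less_base[of _ 2 e]) auto
    then show ?thesis by (auto simp: dist_norm)
  qed
  have dec: "S n \<subseteq> S m" if "m \<le> n" for m n
  proof -
    have "1 / real (Suc n) \<le> 1 / real (Suc m)"
      using that by (simp add: frac_le)
    then show ?thesis by (auto simp: S_def)
  qed
  have "closed (S n)" for n
    using assms(1) by (simp add: S_def closed_Int)
  then obtain p where p: "\<And>n. p \<in> S n"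
    using decreasing_closed_nest[of S, OF _ ne dec small] by blast
  have "dist x p \<le> d"
  proof (rule field_le_epsilon)
    fix e :: real assume "e > 0"
    then obtain n where "1 / real (Suc n) < e"
      using nat_approx_posE by blast
    then show "dist x p \<le> d + e"
      using p[of n] by (auto simp: S_def)
  qed
  then have "\<forall>y\<in>C. dist x p \<le> dist x y"
    using dle by (force simp: dist_norm)
  moreover have "p \<in> C" using p[of 0] by (simp add: S_def)
  ultimately show ?thesis
    using any_closest_point_dot[OF assms(2,1)] by blast
qed

text \<open>The point \<open>e\<close> of the hyperplane \<open>A u = 1\<close> nearest to the
  origin is orthogonal to the kernel of \<open>A\<close>, so \<open>A\<close> is a multiple of the
  inner product with \<open>e\<close>.\<close>

lemma riesz_representation:
  fixes A :: "'a::{real_inner, complete_space} \<Rightarrow> real"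
  assumes "bounded_linear A"
  shows "\<exists>a. \<forall>u. A u = inner a u"
proof (cases "\<exists>w. A w \<noteq> 0")
  case False
  then show ?thesis by (intro exI[of _ 0]) simp
next
  case True
  interpret A: bounded_linear A by fact
  define C where "C = {u. A u = 1}"
  have "closed C" unfolding C_def
    by (intro closed_Collect_eq continuous_intros A.continuous_on)
  moreover have "convex C"
    by (auto simp: C_def convex_def A.add A.scaleR)
  moreover obtain w where w: "A w \<noteq> 0" using True by blast
  then have "(1 / A w) *\<^sub>R w \<in> C" by (simp add: C_def A.scaleR)
  ultimately obtain e where e: "A e = 1" "\<And>y. A y = 1 \<Longrightarrow> inner (0 - e) (y - e) \<le> 0"
    using hilbert_closest_point_exists[of C 0] by (auto simp: C_def)
  have ker: "inner e k = 0" if "A k = 0" for k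
    using e(2)[of "e + k"] e(2)[of "e - k"] that e(1) by (simp add: A.add A.diff)
  have "e \<noteq> 0" using e(1) A.zero by auto
  have "A u = inner ((1 / inner e e) *\<^sub>R e) u" for u
    using ker[of "u - A u *\<^sub>R e"] \<open>e \<noteq> 0\<close> e(1)
    by (simp add: A.diff A.scaleR inner_diff_right field_simps)
  then show ?thesis by blast
qed

text \<open>Selected by the variational inequality rather than by minimal distance, since this is
  the form in which the projection is used. The choice is meaningful for nonempty closed convex
  \<open>C\<close>.\<close>

definition hilbert_proj :: "'a::real_inner set \<Rightarrow> 'a \<Rightarrow> 'a" where
  "hilbert_proj C x = (SOME p. p \<in> C \<and> (\<forall>y\<in>C. inner (x - p) (y - p) \<le> 0))"

context
  fixes C :: "'a::{real_inner, complete_space} set"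
  assumes C: "closed C" "convex C" "C \<noteq> {}"
begin

lemma hilbert_proj_in: "hilbert_proj C x \<in> C"
  and hilbert_proj_dot: "y \<in> C \<Longrightarrow> inner (x - hilbert_proj C x) (y - hilbert_proj C x) \<le> 0"
proof -
  have "\<exists>p. p \<in> C \<and> (\<forall>y\<in>C. inner (x - p) (y - p) \<le> 0)"
    using hilbert_closest_point_exists[OF C, of x] by blast
  from someI_ex[OF this, folded hilbert_proj_def]
  show "hilbert_proj C x \<in> C"
    and "y \<in> C \<Longrightarrow> inner (x - hilbert_proj C x) (y - hilbert_proj C x) \<le> 0"
    by auto
qed

lemma hilbert_proj_unique:
  assumes "p \<in> C" "\<And>y. y \<in> C \<Longrightarrow> inner (x - p) (y - p) \<le> 0"
  shows "hilbert_proj C x = p"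
proof -
  let ?q = "hilbert_proj C x"
  have "inner (x - p) (?q - p) \<le> 0" "inner (x - ?q) (p - ?q) \<le> 0"
    using assms hilbert_proj_in hilbert_proj_dot by auto
  then have "inner (?q - p) (?q - p) \<le> 0"
    by (simp add: inner_diff_left inner_diff_right inner_commute)
  then show ?thesis by (metis inner_gt_zero_iff not_less eq_iff_diff_eq_0)
qed

lemma hilbert_proj_dist_le:
  assumes "y \<in> C"
  shows "norm (x - hilbert_proj C x) \<le> norm (x - y)"
proof -
  let ?p = "hilbert_proj C x"
  have "(norm (x - y))\<^sup>2 = (norm (x - ?p))\<^sup>2 + (norm (y - ?p))\<^sup>2 - 2 * inner (x - ?p) (y - ?p)"
    by (simp add: power2_norm_eq_inner inner_diff_left inner_diff_right inner_commute)
  then have "(norm (x - ?p))\<^sup>2 \<le> (norm (x - y))\<^sup>2"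
    using hilbert_proj_dot[OF assms, of x] zero_le_power2[of "norm (y - ?p)"] by linarith
  then show ?thesis by (rule power2_le_imp_le) simp
qed

text \<open>Expanding the square of \<open>x - y = (a - b) + (p - q)\<close>, the cross terms are
  nonnegative by the two variational inequalities. The residual is the gradient of half the squared
  distance to \<open>C\<close>, so this bounds the Lipschitz constant of that gradient.\<close>

lemma hilbert_proj_residual_nonexpansive:
  "norm ((x - hilbert_proj C x) - (y - hilbert_proj C y)) \<le> norm (x - y)"
proof -
  define a b p q where "a = x - hilbert_proj C x" and "b = y - hilbert_proj C y"
    and "p = hilbert_proj C x" and "q = hilbert_proj C y"
  have "inner a (q - p) \<le> 0" "inner b (p - q) \<le> 0"
    using hilbert_proj_dot hilbert_proj_in by (auto simp: a_def b_def p_def q_def)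
  moreover have "x - y = (a - b) + (p - q)"
    by (simp add: a_def b_def p_def q_def)
  then have "(norm (x - y))\<^sup>2 = (norm (a - b))\<^sup>2 + (norm (p - q))\<^sup>2
      - 2 * inner a (q - p) - 2 * inner b (p - q)"
    by (simp add: power2_norm_eq_inner inner_diff_left inner_diff_right inner_add_left
        inner_add_right inner_commute)
  ultimately have "(norm (a - b))\<^sup>2 \<le> (norm (x - y))\<^sup>2"
    using zero_le_power2[of "norm (p - q)"] by linarith
  then show ?thesis unfolding a_def b_def by (rule power2_le_imp_le) simp
qed

text \<open>Together the bounds say that the squared distance to \<open>C\<close> has gradient
  \<open>2 a\<close> at \<open>x\<close>: the first is the subgradient inequality, and the second,
  obtained by measuring from \<open>y\<close> to the old projection of \<open>x\<close>, limits the
  error to a square.\<close>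

lemma hilbert_dist_sq_bounds:
  fixes x y :: 'a
  defines "a \<equiv> x - hilbert_proj C x" and "b \<equiv> y - hilbert_proj C y"
  shows "(norm a)\<^sup>2 + 2 * inner a (y - x) \<le> (norm b)\<^sup>2"
    and "(norm b)\<^sup>2 \<le> (norm a)\<^sup>2 + 2 * inner a (y - x) + (norm (y - x))\<^sup>2"
proof -
  define p q where "p = hilbert_proj C x" and "q = hilbert_proj C y"
  have "inner a (q - p) \<le> 0"
    using hilbert_proj_dot hilbert_proj_in by (auto simp: a_def p_def q_def)
  moreover have "y - x = b - a + (q - p)"
    by (simp add: a_def b_def p_def q_def)
  moreover have "(norm b)\<^sup>2 - (norm a)\<^sup>2 - 2 * inner a (b - a) = (norm (b - a))\<^sup>2"
    by (simp add: power2_norm_eq_inner inner_diff_left inner_diff_right inner_commute)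
  ultimately show "(norm a)\<^sup>2 + 2 * inner a (y - x) \<le> (norm b)\<^sup>2"
    using zero_le_power2[of "norm (b - a)"] inner_add_right[of a "b - a" "q - p"]
    by (smt (verit))
  have "(norm b)\<^sup>2 \<le> (norm (y - p))\<^sup>2"
    using hilbert_proj_dist_le[of p y] hilbert_proj_in[of x] by (simp add: b_def p_def)
  also have "y - p = a + (y - x)" by (simp add: a_def p_def)
  also have "(norm (a + (y - x)))\<^sup>2 = (norm a)\<^sup>2 + 2 * inner a (y - x) + (norm (y - x))\<^sup>2"
    by (simp add: power2_norm_eq_inner inner_add_left inner_add_right inner_commute)
  finally show "(norm b)\<^sup>2 \<le> (norm a)\<^sup>2 + 2 * inner a (y - x) + (norm (y - x))\<^sup>2" .
qed

end

section \<open>Convexity and gradients from first-order estimates\<close>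

lemma convex_on_if_subgradient:
  fixes F :: "'a::real_inner \<Rightarrow> real"
  assumes "\<And>x y. F x + inner (G x) (y - x) \<le> F y"
  shows "convex_on UNIV F"
proof (rule convex_onI)
  fix t :: real and x y :: 'a assume t: "t > 0" "t < 1"
  \<comment> \<open>The subgradient inequality at \<open>z\<close> is tested at \<open>x\<close> and
    \<open>y\<close>; in the weighted average the linear terms cancel.\<close>
  define z where "z = (1 - t) *\<^sub>R x + t *\<^sub>R y"
  have "(1 - t) * (F z + inner (G z) (x - z)) \<le> (1 - t) * F x"
    and "t * (F z + inner (G z) (y - z)) \<le> t * F y"
    using assms t by (auto intro!: mult_left_mono)
  moreover have "(1 - t) * inner (G z) (x - z) + t * inner (G z) (y - z)
      = inner (G z) ((1 - t) *\<^sub>R (x - z) + t *\<^sub>R (y - z))"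
    by (simp add: inner_add_right)
  moreover have "(1 - t) *\<^sub>R (x - z) + t *\<^sub>R (y - z) = 0"
    by (simp add: z_def algebra_simps)
  ultimately have "(1 - t) * F z + t * F z \<le> (1 - t) * F x + t * F y"
    unfolding distrib_left by simp
  then show "F ((1 - t) *\<^sub>R x + t *\<^sub>R y) \<le> (1 - t) * F x + t * F y"
    unfolding z_def[symmetric] by (simp add: left_diff_distrib)
qed simp

lemma GDERIV_if_quadratic_error:
  fixes F :: "'a::real_inner \<Rightarrow> real"
  assumes "0 < d" "\<And>y. norm (y - x) < d \<Longrightarrow> \<bar>F y - F x - inner D (y - x)\<bar> \<le> K * (norm (y - x))\<^sup>2"
  shows "GDERIV F x :> D"
  unfolding gderiv_def has_derivative_at_alt
proof (intro conjI allI impI)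
  show "bounded_linear (\<lambda>h. inner h D)" by (rule bounded_linear_inner_left)
  fix e :: real assume "e > 0"
  \<comment> \<open>\<open>k\<close> is a positive bound for \<open>K\<close>, so that
    \<open>e / k\<close> is a valid radius.\<close>
  define k where "k = \<bar>K\<bar> + 1"
  have k: "k > 0" "K \<le> k" by (auto simp: k_def)
  show "\<exists>d>0. \<forall>y. norm (y - x) < d \<longrightarrow> norm (F y - F x - inner (y - x) D) \<le> e * norm (y - x)"
  proof (intro exI[of _ "min d (e / k)"] conjI allI impI)
    fix y assume y: "norm (y - x) < min d (e / k)"
    then have "\<bar>F y - F x - inner D (y - x)\<bar> \<le> K * (norm (y - x))\<^sup>2"
      using assms(2) by simp
    also have "\<dots> \<le> (k * norm (y - x)) * norm (y - x)"
      using k(2) by (simp add: power2_eq_square mult_right_mono flip: mult.assoc)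
    also have "\<dots> \<le> e * norm (y - x)"
      using y k by (intro mult_right_mono) (auto simp: field_simps)
    finally show "norm (F y - F x - inner (y - x) D) \<le> e * norm (y - x)"
      by (simp add: inner_commute)
  qed (use assms(1) \<open>e > 0\<close> k in auto)
qed

section \<open>The outer unit normal\<close>

text \<open>If \<open>v\<close> and \<open>w\<close> lie strictly on the same side of the tangent
  hyperplane, then so does the segment between them. Scaled down and moved to \<open>x\<close>, it
  misses the zero set of \<open>g\<close>, because the linear part beats the remainder; being
  connected and starting in the interior, it ends there too.\<close>

lemma hypersurface_transversal_interior:
  fixes V :: "'a::real_normed_vector set"
  assumes V: "convex V" "x \<in> V" "x \<in> frontier V" and U: "open U" "x \<in> U"
    and g: "(g has_derivative A) (at x)" "frontier V \<inter> U = {y\<in>U. g y = (0::real)}"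
    and v: "x + v \<in> interior V" and vw: "0 < A v * A w"
  shows "\<exists>t>0. x + t *\<^sub>R w \<in> interior V"
proof -
  interpret A: bounded_linear A using g(1) by (rule has_derivative_bounded_linear)
  \<comment> \<open>On the segment \<open>A\<close> keeps its sign, so \<open>m\<close> bounds
    \<open>\<bar>A k\<bar>\<close> from below, while \<open>M\<close> bounds \<open>norm k\<close>.
    The remainder rate \<open>m / (2 * M)\<close> then leaves an error of at most half of the linear
    part.\<close>
  define m M where "m = min \<bar>A v\<bar> \<bar>A w\<bar>" and "M = max (norm v) (norm w) + 1"
  have m: "m > 0" using vw by (auto simp: m_def)
  have M: "M > 0" unfolding M_def using norm_ge_zero[of v] by linarith
  obtain d1 where d1: "d1 > 0" "ball x d1 \<subseteq> U"
    using U openE by blast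
  obtain d2 where d2: "d2 > 0"
    "\<And>y. norm (y - x) < d2 \<Longrightarrow> norm (g y - g x - A (y - x)) \<le> m / (2 * M) * norm (y - x)"
    using conjunct2[OF g(1)[unfolded has_derivative_at_alt], rule_format, of "m / (2 * M)"] m M
    by auto
  define t where "t = min 1 (min d1 d2 / (2 * M))"
  have t: "0 < t" "t \<le> 1" using d1 d2 M by (auto simp: t_def)
  have "t * M \<le> min d1 d2 / (2 * M) * M"
    using M by (intro mult_right_mono) (auto simp: t_def)
  then have tM: "t * M < d1" "t * M < d2"
    using M d1 d2 by (auto simp: min_def split: if_splits)
  have gx: "g x = 0" using V U g(2) by auto
  have off: "x + t *\<^sub>R k \<notin> frontier V" if k: "k \<in> closed_segment v w" for k
  proof -
    obtain u where u: "0 \<le> u" "u \<le> 1" "k = (1 - u) *\<^sub>R v + u *\<^sub>R w"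
      using k by (auto simp: in_segment)
    have Ak: "A k = (1 - u) * A v + u * A w" by (simp add: u A.add A.scaleR)
    have mk: "m \<le> \<bar>A k\<bar>"
    proof (cases "A v > 0")
      case True
      then have "A w > 0" using vw by (simp add: zero_less_mult_iff)
      then have "(1 - u) * m + u * m \<le> A k"
        unfolding Ak using True u by (intro add_mono mult_left_mono) (auto simp: m_def)
      then show ?thesis by (simp add: algebra_simps)
    next
      case False
      then have "A v < 0" "A w < 0" using vw by (auto simp: zero_less_mult_iff)
      then have "(1 - u) * m + u * m \<le> (1 - u) * (- A v) + u * (- A w)"
        using u by (intro add_mono mult_left_mono) (auto simp: m_def)
      then show ?thesis using Ak by (simp add: algebra_simps)
    qed
    have "closed_segment v w \<subseteq> cball 0 M"
      by (rule closed_segment_subset) (auto simp: M_def)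
    then have kM: "norm k \<le> M" using k by auto
    then have tk: "t * norm k \<le> t * M" using t by simp
    have nk: "norm (t *\<^sub>R k) = t * norm k" using t by simp
    have "norm (g (x + t *\<^sub>R k) - g x - A (t *\<^sub>R k)) \<le> m / (2 * M) * norm (t *\<^sub>R k)"
      using d2(2)[of "x + t *\<^sub>R k"] tk tM t by simp
    also have "\<dots> \<le> m / (2 * M) * (t * M)"
      unfolding nk using m M kM t by (intro mult_left_mono) auto
    also have "\<dots> = t * m / 2" using M by simp
    also have "\<dots> < t * m" using t m by simp
    also have "\<dots> \<le> \<bar>A (t *\<^sub>R k)\<bar>"
      using mk t by (simp add: A.scaleR abs_mult)
    finally have "g (x + t *\<^sub>R k) \<noteq> 0" using gx by auto
    moreover have "x + t *\<^sub>R k \<in> U"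
      using d1(2) tk tM nk by (auto simp: dist_norm)
    ultimately show ?thesis using g(2) by blast
  qed
  have "x + t *\<^sub>R v \<in> interior V"
    using convex_interior_shrink[OF V(1) v V(2) t] by simp
  define K where "K = (\<lambda>k. x + t *\<^sub>R k) ` closed_segment v w"
  have "connected K" unfolding K_def
    by (intro connected_continuous_image continuous_intros) simp
  moreover have "K \<inter> interior V \<noteq> {}"
    using \<open>x + t *\<^sub>R v \<in> interior V\<close> by (auto simp: K_def)
  moreover have "K \<inter> frontier (interior V) = {}"
    using off frontier_interior_subset[of V] by (auto simp: K_def)
  ultimately have "K \<subseteq> interior V"
    using connected_Int_frontier by blast
  then show ?thesis using t by (auto simp: K_def)
qed

text \<open>The normal is the normalised Riesz vector of the derivative of a defining function, with
  the sign that makes directions into the interior negative. The last clause, that every direction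
  with negative product enters the interior, is what yields uniqueness.\<close>

lemma hypersurface_unit_normal:
  fixes V :: "'a::{real_inner, complete_space} set"
  assumes V: "closed V" "convex V" "interior V \<noteq> {}" "c1_hypersurface (frontier V)"
    and x: "x \<in> frontier V"
  shows "\<exists>n. norm n = 1 \<and> (\<forall>y\<in>V. inner n (y - x) \<le> 0) \<and>
    (\<forall>w. inner n w < 0 \<longrightarrow> (\<exists>t>0. x + t *\<^sub>R w \<in> interior V))"
proof -
  obtain U g and g' :: "'a \<Rightarrow> 'a \<Rightarrow>\<^sub>L real" where U: "open U" "x \<in> U"
    and gd: "\<forall>y\<in>U. (g has_derivative blinfun_apply (g' y)) (at y)"
    and g0: "\<forall>y\<in>U. g' y \<noteq> 0" and gS: "frontier V \<inter> U = {y\<in>U. g y = 0}"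
    using bspec[OF V(4)[unfolded c1_hypersurface_def] x] by (elim exE conjE) rule
  define A where "A = blinfun_apply (g' x)"
  have gA: "(g has_derivative A) (at x)" using gd U by (simp add: A_def)
  interpret A: bounded_linear A using gA by (rule has_derivative_bounded_linear)
  have xV: "x \<in> V" using x V(1) frontier_subset_closed by blast
  have xi: "x \<notin> interior V" using x by (simp add: frontier_def)
  note trans = hypersurface_transversal_interior[OF V(2) xV x U gA gS]
  \<comment> \<open>Two opposite directions into the interior would put \<open>x\<close> itself into
    it, as a convex combination of the two points.\<close>
  have opp: False if "x + s *\<^sub>R w \<in> interior V" "x - t *\<^sub>R w \<in> interior V" "s > 0" "t > 0" for s t w
  proof -
    have "(t / (s + t)) *\<^sub>R (x + s *\<^sub>R w) + (s / (s + t)) *\<^sub>R (x - t *\<^sub>R w) \<in> interior V"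
      using that V(2) by (intro convexD) (auto simp: add_divide_distrib[symmetric])
    moreover have "(t / (s + t)) *\<^sub>R (x + s *\<^sub>R w) + (s / (s + t)) *\<^sub>R (x - t *\<^sub>R w)
        = (t / (s + t) + s / (s + t)) *\<^sub>R x"
      by (simp add: algebra_simps)
    moreover have "t / (s + t) + s / (s + t) = 1"
      using that by (simp add: add_divide_distrib[symmetric])
    ultimately show False using xi by simp
  qed
  \<comment> \<open>If a vector into the interior were tangent, perturbing it to both sides of the tangent
     hyperplane would make \<open>w\<close> and \<open>-w\<close> both point into the interior.\<close>
  have ne: "A v \<noteq> 0" if v: "x + v \<in> interior V" for v
  proof
    assume Av: "A v = 0"
    have "g' x \<noteq> 0" using g0 U by blast
    then obtain w where w: "A w \<noteq> 0"
      unfolding A_def by (metis blinfun_eqI zero_blinfun.rep_eq)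
    obtain d where d: "d > 0" "ball (x + v) d \<subseteq> interior V"
      using openE[OF open_interior v] by blast
    define k where "k = norm w + 1"
    have k: "k > 0" "norm w \<le> k" by (simp_all add: k_def add_nonneg_pos)
    define s where "s = d / (2 * k)"
    have s: "s > 0" using d k by (simp add: s_def)
    have "norm (s *\<^sub>R w) < d"
    proof -
      have "norm (s *\<^sub>R w) \<le> s * k" using s k by simp
      also have "\<dots> = d / 2" using k by (simp add: s_def)
      finally show ?thesis using d by simp
    qed
    then have "x + v + s *\<^sub>R w \<in> interior V" "x + v - s *\<^sub>R w \<in> interior V"
      using d(2) by (auto simp: dist_norm)
    then have "x + (v + s *\<^sub>R w) \<in> interior V" "x + (v - s *\<^sub>R w) \<in> interior V"
      by (simp_all add: algebra_simps)
    moreover have "0 < s * (A w * A w)"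
      using s w by (intro mult_pos_pos[OF s]) (auto simp: zero_less_mult_iff)
    then have "0 < A (v + s *\<^sub>R w) * A w" "0 < A (v - s *\<^sub>R w) * A (- w)"
      using Av by (simp_all add: A.add A.diff A.scaleR A.neg mult.assoc)
    ultimately obtain t t' where "t > 0" "x + t *\<^sub>R w \<in> interior V"
      "t' > 0" "x + t' *\<^sub>R (- w) \<in> interior V"
      using trans by meson
    then show False using opp[of t w t'] by simp
  qed
  obtain c where c: "c \<in> interior V" using V(3) by blast
  define v0 where "v0 = c - x"
  have v0: "x + v0 \<in> interior V" using c by (simp add: v0_def)
  \<comment> \<open>The sign makes \<open>B\<close> negative at \<open>v0\<close>. As the factor
    squares to 1, products of two values are the same for \<open>A\<close> and
    \<open>B\<close>.\<close>
  define B where "B u = - sgn (A v0) * A u" for u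
  have Bl: "bounded_linear B"
    unfolding B_def by (intro bounded_linear_const_mult A.bounded_linear_axioms)
  interpret B: bounded_linear B by fact
  have B0: "B v0 < 0" using ne[OF v0] by (auto simp: B_def sgn_real_def)
  have AB: "A u * A w = B u * B w" for u w
    using ne[OF v0] by (simp add: B_def sgn_real_def)
  have Bint: "B v < 0" if "x + v \<in> interior V" for v
  \<comment> \<open>If \<open>B v > 0\<close>, then \<open>v\<close> and \<open>- v0\<close> lie on
    the same side, so \<open>- v0\<close> also leads into the interior, against
    \<open>opp\<close>.\<close>
  proof (rule ccontr)
    assume "\<not> B v < 0"
    moreover have "B v \<noteq> 0" using ne[OF that] ne[OF v0] by (simp add: B_def sgn_zero_iff)
    ultimately have "0 < A v * A (- v0)"
      unfolding AB using B0 by (simp add: B.neg mult_pos_neg)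
    from trans[OF that this] obtain t where "t > 0" "x + t *\<^sub>R (- v0) \<in> interior V" by blast
    then show False using opp[of 1 v0 t] v0 by simp
  qed
  have Bin: "\<exists>t>0. x + t *\<^sub>R w \<in> interior V" if "B w < 0" for w
    using trans[OF v0, of w] AB[of v0 w] B0 that by (simp add: mult_neg_neg)
  obtain a where a: "\<And>u. B u = inner a u" using riesz_representation[OF Bl] by blast
  have "a \<noteq> 0" using B0 a by auto
  define n where "n = (1 / norm a) *\<^sub>R a"
  have nB: "inner n u < 0 \<longleftrightarrow> B u < 0" for u
    using \<open>a \<noteq> 0\<close> by (simp add: n_def a divide_less_0_iff)
  have "norm n = 1" using \<open>a \<noteq> 0\<close> by (simp add: n_def)
  moreover have "inner n (y - x) \<le> 0" if y: "y \<in> V" for y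
  proof (rule ccontr)
    assume neg: "\<not> inner n (y - x) \<le> 0"
    define p where "p = inner n (y - x)"
    define q where "q = - inner n v0"
    have p: "p > 0" using neg by (simp add: p_def)
    have q: "q > 0" using B0 nB[of v0] by (simp add: q_def)
    \<comment> \<open>With this \<open>e\<close> the point on the way from \<open>y\<close> to
      \<open>c\<close> lies exactly on the hyperplane through \<open>x\<close> orthogonal to
      \<open>n\<close>, although it is interior and should lie strictly below.\<close>
    define e where "e = p / (p + q)"
    have e: "0 < e" "e \<le> 1" using p q by (auto simp: e_def)
    have "x + ((y - x) + e *\<^sub>R (c - y)) \<in> interior V"
      using convex_interior_shrink[OF V(2) c y e] by (simp add: algebra_simps)
    then have "inner n ((y - x) + e *\<^sub>R (c - y)) < 0" using Bint nB by blast
    moreover have "inner n ((y - x) + e *\<^sub>R (c - y)) = p + e * (- q - p)"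
      by (simp add: p_def q_def v0_def inner_add_right inner_diff_right)
    moreover have "e * (- q - p) = - p" using p q by (simp add: e_def field_simps)
    ultimately show False by simp
  qed
  ultimately show ?thesis using nB Bin by blast
qed

text \<open>If the two unit vectors differ, \<open>m - n\<close> has negative product with
  \<open>n\<close> and so leads into the interior, but positive product with \<open>m\<close>, which
  supports \<open>V\<close> at \<open>x\<close>.\<close>

lemma unit_normal_unique:
  fixes n m :: "'a::real_inner"
  assumes n: "norm n = 1" "\<forall>w. inner n w < 0 \<longrightarrow> (\<exists>t>0. x + t *\<^sub>R w \<in> interior V)"
    and m: "norm m = 1" "\<forall>y\<in>V. inner m (y - x) \<le> 0"
  shows "m = n"
proof (rule ccontr)
  assume "m \<noteq> n"
  have nn: "inner n n = 1" "inner m m = 1"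
    using n(1) m(1) by (simp_all add: dot_square_norm)
  have "0 < inner (m - n) (m - n)" using \<open>m \<noteq> n\<close> by simp
  then have c: "inner n m < 1"
    using nn by (simp add: inner_diff_left inner_diff_right inner_commute)
  then have "inner n (m - n) < 0" using nn by (simp add: inner_diff_right)
  then obtain t where t: "t > 0" "x + t *\<^sub>R (m - n) \<in> interior V" using n(2) by blast
  then have "inner m (x + t *\<^sub>R (m - n) - x) \<le> 0" using m(2) interior_subset by blast
  then have "t * (1 - inner n m) \<le> 0"
    using nn by (simp add: inner_diff_right inner_commute)
  then show False using t c by (simp add: mult_le_0_iff)
qed

locale smooth_convex_body =
  fixes V :: "'a::{real_inner, complete_space} set"
  assumes closed_V: "closed V" and convex_V: "convex V" and interior_V: "interior V \<noteq> {}"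
    and hypersurface_V: "c1_hypersurface (frontier V)"
begin

abbreviation "S \<equiv> frontier V"
abbreviation "N \<equiv> outer_normal V"

lemma frontier_in_V: "x \<in> S \<Longrightarrow> x \<in> V"
  using closed_V frontier_subset_closed by blast

lemma outer_normal_eqI:
  assumes "x \<in> S" "norm m = 1" "\<And>y. y \<in> V \<Longrightarrow> inner m (y - x) \<le> 0"
  shows "N x = m"
  unfolding outer_normal_def
proof (rule the_equality)
  obtain n where n: "norm n = 1" "\<forall>y\<in>V. inner n (y - x) \<le> 0"
    "\<forall>w. inner n w < 0 \<longrightarrow> (\<exists>t>0. x + t *\<^sub>R w \<in> interior V)"
    using hypersurface_unit_normal[OF closed_V convex_V interior_V hypersurface_V assms(1)] by blast
  fix k assume "norm k = 1 \<and> (\<forall>y\<in>V. inner k (y - x) \<le> 0)"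
  then have "k = n" using unit_normal_unique[OF n(1,3)] by blast
  moreover have "m = n" using unit_normal_unique[OF n(1,3)] assms(2,3) by blast
  ultimately show "k = m" by simp
qed (use assms in auto)

lemma
  assumes "x \<in> S"
  shows norm_N [simp]: "norm (N x) = 1"
    and N_le_0: "y \<in> V \<Longrightarrow> inner (N x) (y - x) \<le> 0"
    and N_inward: "\<exists>t>0. x - t *\<^sub>R N x \<in> interior V"
proof -
  obtain n where n: "norm n = 1" "\<forall>y\<in>V. inner n (y - x) \<le> 0"
    "\<forall>w. inner n w < 0 \<longrightarrow> (\<exists>t>0. x + t *\<^sub>R w \<in> interior V)"
    using hypersurface_unit_normal[OF closed_V convex_V interior_V hypersurface_V assms] by blast
  have Nn: "N x = n" using outer_normal_eqI[OF assms n(1)] n(2) by blast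
  show "norm (N x) = 1" "y \<in> V \<Longrightarrow> inner (N x) (y - x) \<le> 0" using n Nn by auto
  have "inner n (- n) < 0" using n(1) by (simp add: dot_square_norm)
  then obtain t where "t > 0" "x + t *\<^sub>R (- n) \<in> interior V" using n(3) by blast
  then show "\<exists>t>0. x - t *\<^sub>R N x \<in> interior V" using Nn by auto
qed

lemma N_sq [simp]: "x \<in> S \<Longrightarrow> inner (N x) (N x) = 1"
  by (simp add: dot_square_norm)

lemma norm_N_diff_sq:
  assumes "x \<in> S" "y \<in> S"
  shows "(norm (N x - N y))\<^sup>2 = 2 - 2 * inner (N x) (N y)"
  using assms by (simp add: power2_norm_eq_inner inner_diff_left inner_diff_right inner_commute)

end

section \<open>Rolling balls inside the body\<close>

context smooth_convex_body
begin

text \<open>The supporting hyperplane at \<open>y\<close> is tested at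
  \<open>z + r *\<^sub>R N y\<close>, the point of the ball farthest in the direction
  \<open>N y\<close>.\<close>

lemma support_ball:
  assumes "cball z r \<subseteq> V" "0 \<le> r" "y \<in> S"
  shows "r \<le> inner (N y) (y - z)"
proof -
  have "z + r *\<^sub>R N y \<in> cball z r" using assms by (simp add: dist_norm)
  then have "inner (N y) (z + r *\<^sub>R N y - y) \<le> 0" using assms N_le_0 by blast
  then show ?thesis using assms by (simp add: inner_add_right inner_diff_right)
qed

text \<open>A segment from \<open>z\<close> to a point outside \<open>V\<close> crosses the
  boundary, and the crossing is no farther from \<open>z\<close> than its endpoint.\<close>

lemma cball_below_infdist_subset:
  assumes "z \<in> V" "t < infdist z S"
  shows "cball z t \<subseteq> V"
proof (rule ccontr)
  assume "\<not> cball z t \<subseteq> V"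
  then obtain p where p: "dist z p \<le> t" "p \<notin> V"
    by (meson mem_cball subsetI)
  have "closed_segment z p \<inter> S \<noteq> {}"
    using p(2) assms(1) by (intro connected_Int_frontier) auto
  then obtain y where y: "y \<in> closed_segment z p" "y \<in> S" by blast
  then have "infdist z S \<le> dist z p"
    using infdist_le[of y S z] segment_bound1[OF y(1)]
    by (simp add: dist_norm norm_minus_commute)
  then show False using p assms by simp
qed

text \<open>Closest points of the boundary need not exist in infinite dimension, but almost closest
  points \<open>y\<close> already satisfy \<open>y \<approx> z + d *\<^sub>R N y\<close>, because the ball of radius \<open>d\<close> about \<open>z\<close>
  lies on one side of the tangent hyperplane at \<open>y\<close>.\<close>

lemma almost_closest_point:
  fixes z :: 'a
  defines "d \<equiv> infdist z S"
  assumes "z \<in> V" "S \<noteq> {}" "e > 0"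
  shows "\<exists>y\<in>S. norm (y - z - d *\<^sub>R N y) < e"
proof -
  have d: "d \<ge> 0" by (simp add: d_def infdist_nonneg)
  \<comment> \<open>Chosen so that the excess \<open>\<delta> * (2 * d + \<delta>)\<close> of the
    squared distance is at most \<open>e\<^sup>2\<close>.\<close>
  define \<delta> where "\<delta> = min 1 (e\<^sup>2 / (2 * (d + 1)))"
  have \<delta>: "\<delta> > 0" "\<delta> \<le> 1" using d \<open>e > 0\<close> by (auto simp: \<delta>_def)
  have "(INF a\<in>S. dist z a) < d + \<delta>"
    using \<delta> assms(3) by (simp add: d_def infdist_notempty)
  then obtain y where y: "y \<in> S" "dist z y < d + \<delta>"
    using assms(3) by (subst (asm) cINF_less_iff) auto
  have "d \<le> inner (N y) (y - z)"
  \<comment> \<open>Only closed balls of radius \<open>t < d\<close> are known to lie in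
    \<open>V\<close>; each is supported at \<open>y\<close>, and \<open>t\<close> is then driven up
    to \<open>d\<close>.\<close>
  proof (rule dense_le)
    fix t assume t: "t < d"
    show "t \<le> inner (N y) (y - z)"
    proof (cases "0 \<le> t")
      case True
      then show ?thesis
        using t y support_ball cball_below_infdist_subset assms(2) unfolding d_def by blast
    next
      case False
      then show ?thesis using N_le_0[OF y(1) assms(2)] by (simp add: inner_diff_right)
    qed
  qed
  then have "d * d \<le> d * inner (N y) (y - z)" using d by (intro mult_left_mono)
  moreover have "(norm (y - z - d *\<^sub>R N y))\<^sup>2 = (norm (y - z))\<^sup>2 + d * d - 2 * (d * inner (N y) (y - z))"
    using y(1) by (simp add: power2_norm_eq_inner inner_diff_left inner_diff_right inner_commute)
  moreover have "(norm (y - z))\<^sup>2 < (d + \<delta>)\<^sup>2"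
    using y(2) by (intro power_strict_mono) (auto simp: dist_norm norm_minus_commute)
  ultimately have "(norm (y - z - d *\<^sub>R N y))\<^sup>2 < (d + \<delta>)\<^sup>2 - d * d" by linarith
  also have "\<dots> = \<delta> * (2 * d + \<delta>)" by (simp add: power2_eq_square algebra_simps)
  also have "\<dots> \<le> e\<^sup>2 / (2 * (d + 1)) * (2 * (d + 1))"
    using \<delta> d by (intro mult_mono) (auto simp: \<delta>_def)
  also have "\<dots> = e\<^sup>2" using d by simp
  finally have "norm (y - z - d *\<^sub>R N y) < e"
    using \<open>e > 0\<close> by (auto intro: power_less_imp_less_base)
  then show ?thesis using y by blast
qed

section \<open>From a Lipschitz normal to inner balls\<close>

lemma lipschitz_normal_sq:
  assumes L: "L-lipschitz_on S N" "L > 0" and xy: "x \<in> S" "y \<in> S"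
  shows "(1 / L)\<^sup>2 * (2 - 2 * inner (N x) (N y)) \<le> (norm (x - y))\<^sup>2"
proof -
  have "norm (N x - N y) \<le> L * norm (x - y)"
    using lipschitz_onD[OF L(1) xy] by (simp add: dist_norm)
  then have "(1 / L) * norm (N x - N y) \<le> norm (x - y)"
    using L(2) by (simp add: field_simps)
  then have "((1 / L) * norm (N x - N y))\<^sup>2 \<le> (norm (x - y))\<^sup>2"
    using L(2) by (intro power_mono) auto
  then show ?thesis unfolding power_mult_distrib norm_N_diff_sq[OF xy] .
qed

text \<open>If the centre were outside, the inward normal segment would leave \<open>V\<close> at
  some \<open>y = x - t *\<^sub>R N x\<close> with \<open>0 < t \<le> r\<close>. Supporting
  \<open>V\<close> at \<open>y\<close> gives \<open>inner (N x) (N y) \<le> 0\<close>, so the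
  normals differ by at least the square root of 2, while the Lipschitz bound allows at most
  \<open>t / r \<le> 1\<close>.\<close>

lemma inner_center_in_V:
  assumes L: "L-lipschitz_on S N" "L > 0" and x: "x \<in> S"
  shows "x - (1 / L) *\<^sub>R N x \<in> V"
proof (rule ccontr)
  define r where "r = 1 / L"
  have r: "r > 0" using L(2) by (simp add: r_def)
  assume "x - (1 / L) *\<^sub>R N x \<notin> V"
  then have nV: "x - r *\<^sub>R N x \<notin> V" by (simp add: r_def)
  obtain t0 where t0: "t0 > 0" "x - t0 *\<^sub>R N x \<in> interior V" using N_inward[OF x] by blast
  \<comment> \<open>The inward step \<open>t0\<close> may exceed \<open>r\<close>; shrinking it
    towards \<open>x\<close> gives \<open>t1 \<le> r\<close>, so that the exit point is found within
    length \<open>r\<close>.\<close>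
  define e where "e = min 1 (r / t0)"
  define t1 where "t1 = e * t0"
  have e: "0 < e" "e \<le> 1" using r t0 by (auto simp: e_def)
  have "e * t0 \<le> r / t0 * t0" using t0 by (intro mult_right_mono) (auto simp: e_def)
  then have t1: "0 < t1" "t1 \<le> r" using e t0 by (auto simp: t1_def)
  have "x + e *\<^sub>R (x - t0 *\<^sub>R N x - x) \<in> interior V"
    using convex_interior_shrink[OF convex_V t0(2) frontier_in_V[OF x] e] .
  then have "x - t1 *\<^sub>R N x \<in> V" using interior_subset by (auto simp: t1_def)
  then have "closed_segment (x - t1 *\<^sub>R N x) (x - r *\<^sub>R N x) \<inter> S \<noteq> {}"
    using nV by (intro connected_Int_frontier) auto
  then obtain y u where y: "y \<in> S" and u: "0 \<le> u" "u \<le> 1"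
    and yu: "y = (1 - u) *\<^sub>R (x - t1 *\<^sub>R N x) + u *\<^sub>R (x - r *\<^sub>R N x)"
    unfolding closed_segment_def by blast
  define t where "t = (1 - u) * t1 + u * r"
  have y': "x - y = t *\<^sub>R N x" by (simp add: yu t_def algebra_simps)
  have "(1 - u) * t1 + u * t1 \<le> t" "t \<le> (1 - u) * r + u * r"
    unfolding t_def using u t1 by (auto intro!: add_mono mult_left_mono)
  then have t: "0 < t" "t \<le> r" using t1 by (auto simp: algebra_simps)
  have "t * inner (N x) (N y) \<le> 0"
    using N_le_0[OF y frontier_in_V[OF x]] y' by (simp add: inner_commute)
  then have c: "inner (N x) (N y) \<le> 0" using t by (simp add: mult_le_0_iff)
  have "r\<^sup>2 * (2 - 2 * inner (N x) (N y)) \<le> t\<^sup>2"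
    using lipschitz_normal_sq[OF L x y] x t by (simp add: y' r_def)
  also have "\<dots> \<le> r\<^sup>2" using t by (intro power_mono) auto
  finally have "r\<^sup>2 * (1 - 2 * inner (N x) (N y)) \<le> 0" by (simp add: algebra_simps)
  then show False using r c by (simp add: mult_le_0_iff)
qed

lemma lipschitz_normal_imp_inner_ball:
  assumes L: "L-lipschitz_on S N" "L > 0" and x: "x \<in> S"
  shows "cball (x - (1 / L) *\<^sub>R N x) (1 / L) \<subseteq> V"
proof -
  define r where "r = 1 / L"
  define z where "z = x - r *\<^sub>R N x"
  define d where "d = infdist z S"
  have r: "r > 0" using L(2) by (simp add: r_def)
  have zV: "z \<in> V" using inner_center_in_V[OF assms] by (simp add: z_def r_def)
  have "r \<le> d"
  proof (rule ccontr)
    assume "\<not> r \<le> d"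
    define h where "h = r - d"
    have h: "0 < h" "h \<le> r" using \<open>\<not> r \<le> d\<close> infdist_nonneg[of z S] by (auto simp: h_def d_def)
    \<comment> \<open>The errors from using an almost closest point add up to at most
      \<open>5 * r * e\<close>, which must stay below \<open>h\<^sup>2 = 6 * r * e\<close>.\<close>
    define e where "e = h\<^sup>2 / (6 * r)"
    have e: "e > 0" using h r by (simp add: e_def)
    have er: "6 * r * e = h\<^sup>2" using r by (simp add: e_def)
    have "h\<^sup>2 \<le> r\<^sup>2" using h by (intro power_mono) auto
    then have "6 * r * e \<le> r * r" unfolding er by (simp add: power2_eq_square)
    then have er2: "e \<le> r" using r e by (simp add: mult.assoc)
    obtain y where y: "y \<in> S" "norm (y - z - d *\<^sub>R N y) < e"
      using almost_closest_point[OF zV _ e] x unfolding d_def by blast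
    define w where "w = y - z - d *\<^sub>R N y"
    define c where "c = inner (N x) (N y)"
    have w: "norm w < e" using y by (simp add: w_def)
    have xy: "x - y = r *\<^sub>R N x - d *\<^sub>R N y - w" by (simp add: w_def z_def)
    have d0: "0 \<le> d" by (simp add: d_def infdist_nonneg)
    have Nw: "\<bar>inner (N x) w\<bar> \<le> e" "\<bar>inner (N y) w\<bar> \<le> e"
      using Cauchy_Schwarz_ineq2[of "N x" w] Cauchy_Schwarz_ineq2[of "N y" w] w x y(1) by auto
    have "r * c - d - inner (N y) w \<le> 0"
      using N_le_0[OF y(1) frontier_in_V[OF x]] y(1) unfolding xy
      by (simp add: inner_diff_right c_def inner_commute)
    then have rc: "r * c \<le> d + e" using Nw by linarith
    have "r\<^sup>2 * (2 - 2 * c) \<le> (norm (x - y))\<^sup>2"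
      using lipschitz_normal_sq[OF L x y(1)] by (simp add: r_def c_def)
    also have "\<dots> = r\<^sup>2 + d\<^sup>2 - 2 * d * (r * c) - 2 * r * inner (N x) w + 2 * d * inner (N y) w + (norm w)\<^sup>2"
      unfolding xy using x y(1)
      by (simp add: power2_norm_eq_inner inner_diff_left inner_diff_right inner_commute
          c_def) (simp add: power2_eq_square algebra_simps)
    also have "\<dots> \<le> r\<^sup>2 + d\<^sup>2 - 2 * d * (r * c) + 2 * r * e + 2 * d * e + r * e"
    proof -
      have "- (2 * r * inner (N x) w) \<le> 2 * r * e"
        using mult_left_mono[of "- inner (N x) w" e "2 * r"] Nw r by linarith
      moreover have "2 * d * inner (N y) w \<le> 2 * d * e"
        using mult_left_mono[of "inner (N y) w" e "2 * d"] Nw d0 by linarith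
      moreover have "(norm w)\<^sup>2 \<le> r * e"
        unfolding power2_eq_square using w er2 e by (intro mult_mono) auto
      ultimately show ?thesis by linarith
    qed
    finally have "r\<^sup>2 \<le> d\<^sup>2 + 2 * h * (r * c) + 3 * r * e + 2 * d * e"
      by (simp add: h_def power2_eq_square algebra_simps)
    \<comment> \<open>Here \<open>r\<^sup>2 - d\<^sup>2 - 2 * h * d\<close> is exactly
      \<open>h\<^sup>2\<close>, and the remaining terms sum to \<open>5 * r * e\<close> because
      \<open>h + d = r\<close>.\<close>
    also have "\<dots> \<le> d\<^sup>2 + 2 * h * (d + e) + 3 * r * e + 2 * d * e"
      using rc h by (simp add: mult_left_mono)
    finally have "h\<^sup>2 \<le> 5 * r * e"
      by (simp add: h_def power2_eq_square algebra_simps)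
    then show False using er r e mult_pos_pos[OF r e] by linarith
  qed
  \<comment> \<open>Radii strictly below \<open>d\<close> give only the open ball; closedness of
    \<open>V\<close> adds the sphere.\<close>
  then have "ball z r \<subseteq> V"
    using cball_below_infdist_subset[OF zV] unfolding d_def
    by (metis (no_types, lifting) cball_trivial dist_commute less_le_trans mem_ball mem_cball order_refl subsetD subsetI)
  then have "closure (ball z r) \<subseteq> V" using closed_V by (intro closure_minimal)
  then show ?thesis using r by (simp add: z_def r_def)
qed

text \<open>Supporting the ball at \<open>x\<close> gives
  \<open>inner (N x) (x - z) \<ge> r = norm (x - z)\<close>, the equality case of
  Cauchy-Schwarz.\<close>

lemma touching_ball_center:
  assumes "cball z r \<subseteq> V" "0 \<le> r" "x \<in> S" "dist z x = r"
  shows "z = x - r *\<^sub>R N x"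
proof -
  have "r * r \<le> r * inner (N x) (x - z)"
    using support_ball[OF assms(1-3)] assms(2) by (intro mult_left_mono)
  moreover have "(norm (x - z - r *\<^sub>R N x))\<^sup>2 = (norm (x - z))\<^sup>2 + r * r - 2 * (r * inner (N x) (x - z))"
    using assms(3) by (simp add: power2_norm_eq_inner inner_diff_left inner_diff_right inner_commute)
  moreover have "(norm (x - z))\<^sup>2 = r * r"
    using assms(4) by (simp add: dist_norm norm_minus_commute power2_eq_square)
  ultimately have "(norm (x - z - r *\<^sub>R N x))\<^sup>2 \<le> 0" by linarith
  then have "x - z - r *\<^sub>R N x = 0" by simp
  then show ?thesis by (simp add: algebra_simps)
qed

text \<open>The ball touching at \<open>x\<close> is supported at the other boundary point
  \<open>y\<close>.\<close>

lemma inner_ball_imp_cocoercive: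
  assumes "cball (x - r *\<^sub>R N x) r \<subseteq> V" "0 \<le> r" "x \<in> S" "y \<in> S"
  shows "r * ((norm (N x - N y))\<^sup>2 / 2) \<le> inner (N y) (y - x)"
proof -
  have "r \<le> inner (N y) (y - (x - r *\<^sub>R N x))"
    using support_ball[OF assms(1,2,4)] .
  also have "\<dots> = inner (N y) (y - x) + r * inner (N x) (N y)"
    by (simp add: inner_diff_right inner_commute)
  finally show ?thesis
    unfolding norm_N_diff_sq[OF assms(3,4)] by (simp add: field_simps)
qed

text \<open>The inequality is added to itself with \<open>x\<close> and \<open>y\<close> exchanged;
  Cauchy-Schwarz then lets one factor \<open>q\<close> cancel.\<close>

lemma cocoercive_imp_lipschitz:
  assumes L: "L > 0" and co: "\<forall>x\<in>S. \<forall>y\<in>S.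
      inner (N y) (y - x) \<ge> 1 / (2 * L) * (norm (N x - N y))\<^sup>2"
  shows "L-lipschitz_on S N"
proof (rule lipschitz_onI)
  fix x y assume xy: "x \<in> S" "y \<in> S"
  define q where "q = norm (N x - N y)"
  have "1 / (2 * L) * q\<^sup>2 \<le> inner (N y) (y - x)" "1 / (2 * L) * q\<^sup>2 \<le> inner (N x) (x - y)"
    using co xy by (auto simp: q_def norm_minus_commute)
  then have "1 / (2 * L) * q\<^sup>2 + 1 / (2 * L) * q\<^sup>2 \<le> inner (N x - N y) (x - y)"
    by (simp add: inner_diff_left inner_diff_right)
  also have "\<dots> \<le> q * norm (x - y)"
    unfolding q_def by (rule norm_cauchy_schwarz)
  finally have "q * q \<le> q * (L * norm (x - y))"
    using L by (simp add: field_simps power2_eq_square)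
  then have "q \<le> L * norm (x - y)"
    using L norm_ge_zero[of "N x - N y"] unfolding q_def[symmetric]
    by (cases "q = 0") auto
  then show "dist (N x) (N y) \<le> L * dist x y" by (simp add: q_def dist_norm)
qed (use L in simp)

lemma lipschitz_iff_cocoercive:
  assumes L: "L > 0"
  shows "L-lipschitz_on S N \<longleftrightarrow> (\<forall>x\<in>S. \<forall>y\<in>S.
      inner (N y) (y - x) \<ge> 1 / (2 * L) * (norm (N x - N y))\<^sup>2)"
proof
  assume "L-lipschitz_on S N"
  then show "\<forall>x\<in>S. \<forall>y\<in>S. inner (N y) (y - x) \<ge> 1 / (2 * L) * (norm (N x - N y))\<^sup>2"
    using inner_ball_imp_cocoercive[OF lipschitz_normal_imp_inner_ball] L by fastforce
qed (use cocoercive_imp_lipschitz L in blast)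

text \<open>Forwards, the ball of radius \<open>r\<close> is internally tangent at \<open>x\<close>
  to the inner ball of radius \<open>1 / L\<close>, and the strictly smaller radius excludes further
  contact points. Backwards, each ball gives inequality (3) with \<open>r\<close> in place of
  \<open>1 / L\<close>, and \<open>r\<close> tends to \<open>1 / L\<close>.\<close>

lemma lipschitz_iff_touching_balls:
  assumes L: "L > 0"
  shows "L-lipschitz_on S N \<longleftrightarrow> (\<forall>r. 0 < r \<and> r < 1 / L \<longrightarrow>
      (\<forall>x\<in>S. \<exists>z. cball z r \<subseteq> V \<and> sphere z r \<inter> S = {x}))"
proof (intro iffI allI impI ballI)
  fix r x assume lip: "L-lipschitz_on S N" and "0 < r \<and> r < 1 / L" and x: "x \<in> S"
  then have r: "0 < r" "r < 1 / L" by auto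
  define R where "R = 1 / L"
  define z where "z = x - r *\<^sub>R N x"
  define z' where "z' = x - R *\<^sub>R N x"
  have big: "cball z' R \<subseteq> V"
    using lipschitz_normal_imp_inner_ball[OF lip L x] by (simp add: z'_def R_def)
  have rR: "r < R" using r by (simp add: R_def)
  have zz: "z = z' + (R - r) *\<^sub>R N x" by (simp add: z_def z'_def algebra_simps)
  have "cball z r \<subseteq> cball z' R"
  proof
    fix p assume "p \<in> cball z r"
    then show "p \<in> cball z' R"
      using dist_triangle[of z' p z] x rR by (simp add: zz dist_norm)
  qed
  moreover have "p = x" if p: "p \<in> sphere z r" "p \<in> S" for p
  proof -
    define u where "u = p - z"
    have u: "norm u = r" using p(1) by (simp add: u_def dist_norm norm_minus_commute)
    have pz: "p - z' = u + (R - r) *\<^sub>R N x" by (simp add: u_def zz)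
    have "\<not> dist z' p < R"
      using p(2) big interior_maximal[of "ball z' R" V]
      by (auto simp: frontier_def subset_eq)
    then have "R \<le> norm (p - z')" by (simp add: dist_norm norm_minus_commute)
    then have "R\<^sup>2 \<le> (norm (p - z'))\<^sup>2" using r rR by (intro power_mono) auto
    also have "\<dots> = (norm u)\<^sup>2 + (R - r)\<^sup>2 + 2 * (R - r) * inner (N x) u"
      unfolding pz using x
      by (simp add: power2_norm_eq_inner inner_add_left inner_add_right inner_commute)
        (simp add: power2_eq_square)
    finally have "(R - r) * r \<le> (R - r) * inner (N x) u"
      using u by (simp add: power2_eq_square algebra_simps)
    \<comment> \<open>With \<open>norm u = r\<close> this is equality in Cauchy-Schwarz, so
      \<open>u\<close> must be \<open>r *\<^sub>R N x\<close>.\<close>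
    then have iu: "r \<le> inner (N x) u" using rR by simp
    have "(norm (u - r *\<^sub>R N x))\<^sup>2 = (norm u)\<^sup>2 + r * r - 2 * (r * inner (N x) u)"
      using x by (simp add: power2_norm_eq_inner inner_diff_left inner_diff_right inner_commute)
    also have "\<dots> \<le> 0" using mult_left_mono[OF iu, of r] u r by (simp add: power2_eq_square)
    finally have "u = r *\<^sub>R N x" by simp
    then show ?thesis by (simp add: u_def z_def algebra_simps)
  qed
  moreover have "x \<in> sphere z r" using x r by (simp add: z_def dist_norm)
  ultimately show "\<exists>z. cball z r \<subseteq> V \<and> sphere z r \<inter> S = {x}"
    using big x by (intro exI[of _ z]) blast
next
  assume balls: "\<forall>r. 0 < r \<and> r < 1 / L \<longrightarrow>
      (\<forall>x\<in>S. \<exists>z. cball z r \<subseteq> V \<and> sphere z r \<inter> S = {x})"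
  have "1 / (2 * L) * (norm (N x - N y))\<^sup>2 \<le> inner (N y) (y - x)"
    if xy: "x \<in> S" "y \<in> S" for x y
  proof -
    define q where "q = (norm (N x - N y))\<^sup>2 / 2"
    have q: "q \<ge> 0" by (simp add: q_def)
    have le: "r * q \<le> inner (N y) (y - x)" if r: "0 < r" "r < 1 / L" for r
    proof -
      obtain z where z: "cball z r \<subseteq> V" "sphere z r \<inter> S = {x}" using balls r xy by blast
      then have "dist z x = r" by auto
      then have "z = x - r *\<^sub>R N x" using touching_ball_center[OF z(1) _ xy(1)] r by simp
      then show ?thesis
        using inner_ball_imp_cocoercive[of x r y] z(1) r xy by (simp add: q_def)
    qed
    have "(1 / L) * q \<le> inner (N y) (y - x)"
    proof (rule tendsto_upperbound)
      show "((\<lambda>r. r * q) \<longlongrightarrow> 1 / L * q) (at_left (1 / L))"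
        by (intro tendsto_intros)
      show "\<forall>\<^sub>F r in at_left (1 / L). r * q \<le> inner (N y) (y - x)"
        using eventually_at_left_real[of 0 "1 / L"] L
        by (auto elim!: eventually_mono intro!: le)
    qed simp
    then show ?thesis by (simp add: q_def)
  qed
  then show "L-lipschitz_on S N" using cocoercive_imp_lipschitz L by blast
qed

end

section \<open>The convex function attached to the inner parallel body\<close>

context smooth_convex_body
begin

lemma lipschitz_imp_extension:
  assumes L: "L-lipschitz_on S N" "L > 0"
  shows "\<exists>(F :: 'a \<Rightarrow> real) G. convex_on UNIV F \<and> (\<forall>x. GDERIV F x :> G x) \<and>
    L-lipschitz_on UNIV G \<and> S = F -` {1} \<and> (\<forall>x\<in>S. G x = N x)"
proof (cases "S = {}")
  case True
  \<comment> \<open>The constant 0 never takes the value 1, so its level set is empty as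
    well.\<close>
  have "convex_on UNIV (\<lambda>_::'a. 0::real)" by (simp add: convex_on_def)
  moreover have "L-lipschitz_on UNIV (\<lambda>_::'a. 0::'a)" using L(2) by (simp add: lipschitz_on_def)
  ultimately show ?thesis
    using True GDERIV_const by (intro exI[of _ "\<lambda>_. 0"]) auto
next
  case False
  define r where "r = 1 / L"
  have r: "r > 0" "L * r = 1" using L(2) by (auto simp: r_def)
  define C where "C = {p. cball p r \<subseteq> V}"
  \<comment> \<open>As an intersection of translates of \<open>V\<close>, the inner parallel body
    inherits closedness and convexity.\<close>
  have Ceq: "C = (\<Inter>u\<in>cball 0 r. {p. p + u \<in> V})"
  proof -
    have "(cball p r \<subseteq> V) \<longleftrightarrow> (\<forall>u\<in>cball 0 r. p + u \<in> V)" for p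
    proof
      assume *: "\<forall>u\<in>cball 0 r. p + u \<in> V"
      show "cball p r \<subseteq> V"
      proof
        fix q assume "q \<in> cball p r"
        then have "q - p \<in> cball 0 r" by (simp add: dist_norm norm_minus_commute)
        then show "q \<in> V" using * by fastforce
      qed
    qed (auto simp: dist_norm subset_eq)
    then show ?thesis by (auto simp: C_def)
  qed
  have Cclosed: "closed C"
  proof -
    have "closed {p. p + u \<in> V}" for u
      using continuous_closed_vimage[OF closed_V, of "\<lambda>p. p + u"]
      by (simp add: vimage_def)
    then show ?thesis unfolding Ceq by blast
  qed
  have Cconvex: "convex C"
  proof -
    have "convex {p. p + u \<in> V}" for u
    proof (rule convexI)
      fix p q :: 'a and a b :: real
      assume "p \<in> {p. p + u \<in> V}" "q \<in> {p. p + u \<in> V}" and ab: "0 \<le> a" "0 \<le> b" "a + b = 1"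
      then have "a *\<^sub>R (p + u) + b *\<^sub>R (q + u) \<in> V" using convex_V by (auto intro: convexD)
      moreover have "a *\<^sub>R (p + u) + b *\<^sub>R (q + u) = a *\<^sub>R p + b *\<^sub>R q + (a + b) *\<^sub>R u"
        by (simp add: algebra_simps)
      ultimately show "a *\<^sub>R p + b *\<^sub>R q \<in> {p. p + u \<in> V}" using ab by simp
    qed
    then show ?thesis unfolding Ceq by (intro convex_INT) auto
  qed
  have CS: "x - r *\<^sub>R N x \<in> C" if "x \<in> S" for x
    using lipschitz_normal_imp_inner_ball[OF L that] by (simp add: C_def r_def)
  then have Cne: "C \<noteq> {}" using False by blast
  note C = Cclosed Cconvex Cne
  define a where "a x = x - hilbert_proj C x" for x
  define F where "F x = 1 + L / 2 * ((norm (a x))\<^sup>2 - r\<^sup>2)" for x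
  define G where "G x = L *\<^sub>R a x" for x
  have lower: "F x + inner (G x) (y - x) \<le> F y" for x y
    using mult_left_mono[OF hilbert_dist_sq_bounds(1)[OF C, where x = x and y = y], of "L / 2"] L(2)
    by (simp add: F_def G_def a_def algebra_simps)
  have upper: "F y \<le> F x + inner (G x) (y - x) + L / 2 * (norm (y - x))\<^sup>2" for x y
    using mult_left_mono[OF hilbert_dist_sq_bounds(2)[OF C, where x = x and y = y], of "L / 2"] L(2)
    by (simp add: F_def G_def a_def algebra_simps)
  have "convex_on UNIV F" using lower by (rule convex_on_if_subgradient)
  moreover have "GDERIV F x :> G x" for x
  proof (rule GDERIV_if_quadratic_error[where d = 1 and K = "L / 2"])
    show "\<bar>F y - F x - inner (G x) (y - x)\<bar> \<le> L / 2 * (norm (y - x))\<^sup>2" for y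
      using lower[of x y] upper[of y x] by linarith
  qed simp
  moreover have "L-lipschitz_on UNIV G"
  proof (rule lipschitz_onI)
    fix x y
    have "dist (G x) (G y) = L * norm (a x - a y)"
      using L(2) by (simp add: G_def dist_norm flip: scaleR_right_diff_distrib)
    also have "\<dots> \<le> L * dist x y"
      using hilbert_proj_residual_nonexpansive[OF C, of x y] L(2) by (simp add: a_def dist_norm)
    finally show "dist (G x) (G y) \<le> L * dist x y" .
  qed (use L in simp)
  moreover have aS: "a x = r *\<^sub>R N x" if x: "x \<in> S" for x
  proof -
    \<comment> \<open>Every centre in \<open>C\<close> lies at depth at least \<open>r\<close> below
      the supporting hyperplane at \<open>x\<close>, and \<open>x - r *\<^sub>R N x\<close> is at
      depth exactly \<open>r\<close> straight below \<open>x\<close>.\<close>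
    have "hilbert_proj C x = x - r *\<^sub>R N x"
    proof (rule hilbert_proj_unique[OF C CS[OF x]])
      fix p assume "p \<in> C"
      then have "r \<le> inner (N x) (x - p)"
        using support_ball[of p r x] x r by (simp add: C_def)
      then have "r * (inner (N x) (p - x) + r) \<le> 0"
        using r(1) by (simp add: inner_diff_right mult_le_0_iff)
      then show "inner (x - (x - r *\<^sub>R N x)) (p - (x - r *\<^sub>R N x)) \<le> 0"
        using x by (simp add: inner_diff_right inner_add_right algebra_simps)
    qed
    then show ?thesis by (simp add: a_def)
  qed
  moreover have "S = F -` {1}"
  proof (intro equalityI subsetI)
    fix x assume x: "x \<in> S"
    then show "x \<in> F -` {1}" using r(1) by (simp add: F_def aS)
  next
    fix x assume "x \<in> F -` {1}"
    then have "(norm (a x))\<^sup>2 = r\<^sup>2" using L(2) by (simp add: F_def)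
    then have ax: "norm (a x) = r" using r(1) by simp
    define p where "p = hilbert_proj C x"
    have "cball p r \<subseteq> V" using hilbert_proj_in[OF C, of x] by (simp add: C_def p_def)
    then have xV: "x \<in> V" using ax by (auto simp: a_def p_def dist_norm norm_minus_commute)
    show "x \<in> S"
    \<comment> \<open>Suppose \<open>x\<close>, at distance \<open>r\<close> from \<open>C\<close>,
      is interior with distance \<open>d\<close> to the boundary. If \<open>d > r\<close>, then
      \<open>x\<close> itself is in \<open>C\<close>. Otherwise the centre
      \<open>y - r *\<^sub>R N y\<close> for an almost closest \<open>y\<close> is nearer to
      \<open>x\<close> than \<open>r\<close>.\<close>
    proof (rule ccontr)
      assume nS: "x \<notin> S"
      define d where "d = infdist x S"
      have d: "d > 0" unfolding d_def
        using nS False by (intro infdist_pos_not_in_closed) auto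
      have far: "r \<le> norm (x - p)" if "p \<in> C" for p
        using hilbert_proj_dist_le[OF C that, of x] ax by (simp add: a_def)
      show False
      proof (cases "d > r")
        case True
        then have "x \<in> C"
          using cball_below_infdist_subset[OF xV] by (simp add: C_def d_def)
        then show False using far[of x] r by simp
      next
        case False
        obtain y where y: "y \<in> S" "norm (y - x - d *\<^sub>R N y) < d"
          using almost_closest_point[OF xV \<open>S \<noteq> {}\<close> d] by (auto simp: d_def)
        have "x - (y - r *\<^sub>R N y) = (r - d) *\<^sub>R N y - (y - x - d *\<^sub>R N y)"
          by (simp add: algebra_simps)
        then have "norm (x - (y - r *\<^sub>R N y)) \<le> norm ((r - d) *\<^sub>R N y) + norm (y - x - d *\<^sub>R N y)"
          using norm_triangle_ineq4 by metis
        also have "\<dots> < r" using y False by simp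
        finally show False using far[OF CS[OF y(1)]] by simp
      qed
    qed
  qed
  moreover have "G x = N x" if "x \<in> S" for x
    using aS[OF that] r(2) by (simp add: G_def)
  ultimately show ?thesis by blast
qed

lemma lipschitz_iff_extension:
  assumes "L > 0"
  shows "L-lipschitz_on S N \<longleftrightarrow> (\<exists>(F :: 'a \<Rightarrow> real) G. convex_on UNIV F \<and>
    (\<forall>x. GDERIV F x :> G x) \<and> L-lipschitz_on UNIV G \<and> S = F -` {1} \<and> (\<forall>x\<in>S. G x = N x))"
proof
  assume "\<exists>(F :: 'a \<Rightarrow> real) G. convex_on UNIV F \<and>
    (\<forall>x. GDERIV F x :> G x) \<and> L-lipschitz_on UNIV G \<and> S = F -` {1} \<and> (\<forall>x\<in>S. G x = N x)"
  then obtain G where "L-lipschitz_on UNIV G" "\<forall>x\<in>S. G x = N x" by blast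
  then show "L-lipschitz_on S N" unfolding lipschitz_on_def by (metis UNIV_I)
qed (use lipschitz_imp_extension assms in blast)

end

section \<open>The Minkowski functional\<close>

text \<open>A quotient estimate shared by the three normalisations below: by
  \<open>inner (N s) s\<close>, by \<open>\<mu> x\<close> and by the norm of a gradient.\<close>

lemma norm_normalized_diff_le:
  fixes u v :: "'a::real_normed_vector"
  assumes "0 < p" "0 < q"
  shows "norm ((1 / p) *\<^sub>R u - (1 / q) *\<^sub>R v) \<le> (norm (u - v) + norm v / q * \<bar>p - q\<bar>) / p"
proof -
  have "(1 / p) *\<^sub>R u - (1 / q) *\<^sub>R v = (1 / p) *\<^sub>R ((u - v) + ((q - p) / q) *\<^sub>R v)"
    using assms by (simp add: algebra_simps diff_divide_distrib)
  then have "norm ((1 / p) *\<^sub>R u - (1 / q) *\<^sub>R v) = norm ((u - v) + ((q - p) / q) *\<^sub>R v) / p"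
    using assms by simp
  also have "\<dots> \<le> (norm (u - v) + norm (((q - p) / q) *\<^sub>R v)) / p"
    using assms by (intro divide_right_mono norm_triangle_ineq) auto
  also have "norm (((q - p) / q) *\<^sub>R v) = norm v / q * \<bar>p - q\<bar>"
    using assms by (simp add: abs_minus_commute)
  finally show ?thesis .
qed

lemma GDERIV_imp_directional_DERIV:
  assumes "GDERIV f x :> D"
  shows "DERIV (\<lambda>t. f (x + t *\<^sub>R v)) 0 :> inner v D"
proof -
  have "((\<lambda>t::real. x + t *\<^sub>R v) has_derivative (\<lambda>t. t *\<^sub>R v)) (at 0)"
    by (auto intro!: derivative_eq_intros)
  moreover have "(f has_derivative (\<lambda>h. inner h D)) (at (x + 0 *\<^sub>R v))"
    using assms by (simp add: gderiv_def)
  ultimately have "((\<lambda>t. f (x + t *\<^sub>R v)) has_derivative (\<lambda>t. inner (t *\<^sub>R v) D)) (at 0)"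
    by (rule has_derivative_compose)
  then show ?thesis
    by (simp add: has_field_derivative_def mult_commute_abs)
qed

locale bounded_smooth_convex_body = smooth_convex_body V
  for V :: "'a::{real_inner, complete_space} set" +
  fixes \<rho> R :: real
  assumes \<rho>: "\<rho> > 0" "cball 0 \<rho> \<subseteq> V" and R: "R > 0" "\<And>y. y \<in> V \<Longrightarrow> norm y \<le> R"
begin

abbreviation "\<mu> \<equiv> minkowski_functional V"

text \<open>The normal rescaled so that the supporting hyperplane at \<open>s\<close> is the set
  where its product equals 1: the boundary point of the polar body dual to \<open>s\<close>.\<close>

definition dual_normal :: "'a \<Rightarrow> 'a" where
  "dual_normal s = (1 / inner (N s) s) *\<^sub>R N s"

lemma N_dot_ge: "s \<in> S \<Longrightarrow> \<rho> \<le> inner (N s) s"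
  using support_ball[OF \<rho>(2) less_imp_le[OF \<rho>(1)]] by simp

lemma dual_normal_le:
  assumes "s \<in> S"
  shows "v \<in> V \<Longrightarrow> inner (dual_normal s) v \<le> 1" and "inner (dual_normal s) s = 1"
    and "norm (dual_normal s) \<le> 1 / \<rho>"
proof -
  have pos: "0 < inner (N s) s" using N_dot_ge[OF assms] \<rho>(1) by linarith
  show "inner (dual_normal s) s = 1" using pos by (simp add: dual_normal_def)
  show "norm (dual_normal s) \<le> 1 / \<rho>"
    using pos N_dot_ge[OF assms] \<rho>(1) assms by (simp add: dual_normal_def frac_le)
  show "inner (dual_normal s) v \<le> 1" if "v \<in> V"
    using N_le_0[OF assms that] pos by (simp add: dual_normal_def inner_diff_right)
qed

text \<open>The supporting hyperplane at \<open>s\<close> excludes from \<open>V\<close> every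
  multiple of \<open>s\<close> with factor above 1, so no \<open>t < \<tau>\<close> is
  admissible.\<close>

lemma minkowski_scaled:
  assumes s: "s \<in> S" and "\<tau> > 0"
  shows "\<mu> (\<tau> *\<^sub>R s) = \<tau>"
  unfolding minkowski_functional_def
proof (rule cInf_eq_minimum)
  show "\<tau> \<in> {t. t > 0 \<and> inverse t *\<^sub>R \<tau> *\<^sub>R s \<in> V}"
    using frontier_in_V[OF s] \<open>\<tau> > 0\<close> by simp
  fix t assume "t \<in> {t. t > 0 \<and> inverse t *\<^sub>R \<tau> *\<^sub>R s \<in> V}"
  then have t: "t > 0" "(inverse t * \<tau>) *\<^sub>R s \<in> V" by auto
  then have "inner (dual_normal s) ((inverse t * \<tau>) *\<^sub>R s) \<le> 1"
    using dual_normal_le(1)[OF s] by blast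
  then show "\<tau> \<le> t" using dual_normal_le(2)[OF s] t(1) by (simp add: field_simps)
qed

lemma ray_meets_frontier:
  assumes "x \<noteq> 0"
  obtains s \<tau> where "s \<in> S" "\<tau> > 0" "x = \<tau> *\<^sub>R s"
proof -
  define q where "q = ((R + 1) / norm x) *\<^sub>R x"
  have "norm q = R + 1" using assms R(1) by (simp add: q_def)
  then have "q \<notin> V" using R(2) by force
  moreover have "0 \<in> V" using \<rho> by auto
  ultimately have "closed_segment 0 q \<inter> S \<noteq> {}"
    by (intro connected_Int_frontier) auto
  then obtain u where u: "0 \<le> u" "u *\<^sub>R q \<in> S" unfolding closed_segment_def by auto
  have "0 \<notin> S" using N_dot_ge[of 0] \<rho>(1) by auto
  then have "u \<noteq> 0" using u by auto
  define \<tau> where "\<tau> = norm x / (u * (R + 1))"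
  have "\<tau> > 0" using u \<open>u \<noteq> 0\<close> R(1) assms by (simp add: \<tau>_def)
  moreover have "x = \<tau> *\<^sub>R (u *\<^sub>R q)"
    using \<open>u \<noteq> 0\<close> R(1) assms by (simp add: \<tau>_def q_def)
  ultimately show thesis using that u by blast
qed

lemma minkowski_0: "\<mu> 0 = 0"
proof -
  have "0 \<in> V" using \<rho> by auto
  then have "{t. t > 0 \<and> inverse t *\<^sub>R 0 \<in> V} = {0::real<..}" by auto
  then show ?thesis unfolding minkowski_functional_def by simp
qed

lemma minkowski_normalize:
  assumes "x \<noteq> 0"
  shows "\<mu> x > 0" and "(1 / \<mu> x) *\<^sub>R x \<in> S"
proof -
  obtain s \<tau> where *: "s \<in> S" "\<tau> > 0" "x = \<tau> *\<^sub>R s" using ray_meets_frontier[OF assms] .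
  then have "\<mu> x = \<tau>" using minkowski_scaled by simp
  then show "\<mu> x > 0" "(1 / \<mu> x) *\<^sub>R x \<in> S" using * by auto
qed

lemma minkowski_le_1: "y \<in> V \<Longrightarrow> \<mu> y \<le> 1"
  unfolding minkowski_functional_def
proof (rule cInf_lower)
  show "bdd_below {t. 0 < t \<and> inverse t *\<^sub>R y \<in> V}" by (rule bdd_belowI[of _ 0]) auto
qed simp

text \<open>The candidate gradient of \<open>\<mu>\<close>; it is constant along rays, as
  homogeneity of degree 1 demands.\<close>

definition mink_grad :: "'a \<Rightarrow> 'a" where
  "mink_grad x = dual_normal ((1 / \<mu> x) *\<^sub>R x)"

text \<open>The dual normal at the radial projection of \<open>x\<close> is at most 1 on
  \<open>V\<close>, hence at most \<open>\<mu> y\<close> at \<open>y\<close>, with equality at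
  \<open>x\<close>.\<close>

lemma minkowski_subgradient:
  assumes "x \<noteq> 0" "y \<noteq> 0"
  shows "inner (mink_grad x) (y - x) \<le> \<mu> y - \<mu> x"
proof -
  define s where "s = (1 / \<mu> x) *\<^sub>R x"
  have s: "s \<in> S" "\<mu> x > 0" using minkowski_normalize[OF assms(1)] by (auto simp: s_def)
  have "inner (dual_normal s) ((1 / \<mu> y) *\<^sub>R y) \<le> 1"
    using dual_normal_le(1)[OF s(1)] minkowski_normalize[OF assms(2)] frontier_in_V by blast
  then have "inner (dual_normal s) y \<le> \<mu> y"
    using minkowski_normalize(1)[OF assms(2)] by (simp add: field_simps)
  moreover have "inner (dual_normal s) x = \<mu> x"
    using dual_normal_le(2)[OF s(1)] s(2) by (simp add: s_def field_simps)
  ultimately show ?thesis by (simp add: mink_grad_def s_def inner_diff_right)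
qed

lemma minkowski_diff_le:
  assumes "x \<noteq> 0" "y \<noteq> 0"
  shows "\<bar>\<mu> x - \<mu> y\<bar> \<le> norm (x - y) / \<rho>"
proof -
  have *: "\<mu> x - \<mu> y \<le> norm (x - y) / \<rho>" if "x \<noteq> 0" "y \<noteq> 0" for x y
  proof -
    have "\<mu> x - \<mu> y \<le> inner (mink_grad x) (x - y)"
      using minkowski_subgradient[OF that] by (simp add: inner_diff_right)
    also have "\<dots> \<le> norm (mink_grad x) * norm (x - y)" by (rule norm_cauchy_schwarz)
    also have "\<dots> \<le> 1 / \<rho> * norm (x - y)"
      using dual_normal_le(3)[OF minkowski_normalize(2)[OF that(1)]]
      by (intro mult_right_mono) (auto simp: mink_grad_def)
    finally show ?thesis by simp
  qed
  show ?thesis using *[of x y] *[of y x] assms by (simp add: norm_minus_commute abs_le_iff)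
qed

lemma dual_normal_lipschitz:
  assumes L: "L-lipschitz_on S N" and st: "s \<in> S" "t \<in> S"
  shows "norm (dual_normal s - dual_normal t) \<le> (L + (L * R + 1) / \<rho>) / \<rho> * norm (s - t)"
proof -
  define p q where "p = inner (N s) s" and "q = inner (N t) t"
  have pq: "\<rho> \<le> p" "\<rho> \<le> q" using N_dot_ge st by (auto simp: p_def q_def)
  have lip: "norm (N s - N t) \<le> L * norm (s - t)"
    using lipschitz_onD[OF L st] by (simp add: dist_norm)
  have "p - q = inner (N s - N t) s + inner (N t) (s - t)"
    by (simp add: p_def q_def inner_diff_left inner_diff_right)
  then have "\<bar>p - q\<bar> \<le> norm (N s - N t) * norm s + norm (N t) * norm (s - t)"
    using Cauchy_Schwarz_ineq2[of "N s - N t" s] Cauchy_Schwarz_ineq2[of "N t" "s - t"] by linarith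
  also have "\<dots> \<le> (L * norm (s - t)) * R + norm (s - t)"
    using lip R(2)[OF frontier_in_V[OF st(1)]] st lipschitz_on_nonneg[OF L]
    by (intro add_mono mult_mono) auto
  finally have dpq: "\<bar>p - q\<bar> \<le> (L * R + 1) * norm (s - t)" by (simp add: algebra_simps)
  have "norm (dual_normal s - dual_normal t) \<le> (norm (N s - N t) + norm (N t) / q * \<bar>p - q\<bar>) / p"
    unfolding dual_normal_def p_def[symmetric] q_def[symmetric]
    using pq \<rho>(1) by (intro norm_normalized_diff_le) auto
  also have "\<dots> \<le> (L * norm (s - t) + 1 / \<rho> * ((L * R + 1) * norm (s - t))) / \<rho>"
    using lip dpq pq \<rho>(1) st R(1) lipschitz_on_nonneg[OF L]
    by (intro frac_le add_mono mult_mono) auto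
  also have "\<dots> = (L + (L * R + 1) / \<rho>) / \<rho> * norm (s - t)" by (simp add: field_simps)
  finally show ?thesis .
qed

lemma normalize_lipschitz:
  assumes "\<alpha> > 0" "\<mu> x \<ge> \<alpha>" "\<mu> y \<ge> \<alpha>"
  shows "norm ((1 / \<mu> x) *\<^sub>R x - (1 / \<mu> y) *\<^sub>R y) \<le> (1 + R / \<rho>) / \<alpha> * norm (x - y)"
proof -
  have ne: "x \<noteq> 0" "y \<noteq> 0" using assms minkowski_0 by auto
  have "norm ((1 / \<mu> y) *\<^sub>R y) \<le> R"
    using R(2) frontier_in_V minkowski_normalize(2)[OF ne(2)] by blast
  then have yR: "norm y / \<mu> y \<le> R" using assms by simp
  have "norm ((1 / \<mu> x) *\<^sub>R x - (1 / \<mu> y) *\<^sub>R y)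
      \<le> (norm (x - y) + norm y / \<mu> y * \<bar>\<mu> x - \<mu> y\<bar>) / \<mu> x"
    using assms by (intro norm_normalized_diff_le) auto
  also have "\<dots> \<le> (norm (x - y) + R * (norm (x - y) / \<rho>)) / \<alpha>"
    using yR minkowski_diff_le[OF ne] assms R(1) \<rho>(1)
    by (intro frac_le add_mono mult_mono) auto
  also have "\<dots> = (1 + R / \<rho>) / \<alpha> * norm (x - y)" by (simp add: field_simps)
  finally show ?thesis .
qed

lemma mink_grad_lipschitz:
  assumes L: "L-lipschitz_on S N" and "\<alpha> > 0"
  shows "((L + (L * R + 1) / \<rho>) / \<rho> * ((1 + R / \<rho>) / \<alpha>))-lipschitz_on {x. \<mu> x \<ge> \<alpha>} mink_grad"
proof (rule lipschitz_onI)
  have L0: "L \<ge> 0" using lipschitz_on_nonneg[OF L] .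
  then have K: "0 \<le> (L + (L * R + 1) / \<rho>) / \<rho>" using R(1) \<rho>(1) by simp
  then show "0 \<le> (L + (L * R + 1) / \<rho>) / \<rho> * ((1 + R / \<rho>) / \<alpha>)"
    using R(1) \<rho>(1) \<open>\<alpha> > 0\<close> by (intro mult_nonneg_nonneg) auto
  fix x y assume "x \<in> {x. \<mu> x \<ge> \<alpha>}" "y \<in> {x. \<mu> x \<ge> \<alpha>}"
  then have xy: "\<mu> x \<ge> \<alpha>" "\<mu> y \<ge> \<alpha>" by auto
  then have ne: "x \<noteq> 0" "y \<noteq> 0" using \<open>\<alpha> > 0\<close> minkowski_0 by auto
  have "dist (mink_grad x) (mink_grad y)
      \<le> (L + (L * R + 1) / \<rho>) / \<rho> * norm ((1 / \<mu> x) *\<^sub>R x - (1 / \<mu> y) *\<^sub>R y)"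
    unfolding dist_norm mink_grad_def using minkowski_normalize ne
    by (intro dual_normal_lipschitz[OF L])
  also have "\<dots> \<le> (L + (L * R + 1) / \<rho>) / \<rho> * ((1 + R / \<rho>) / \<alpha> * norm (x - y))"
    using K normalize_lipschitz[OF \<open>\<alpha> > 0\<close> xy] by (rule mult_left_mono[rotated])
  finally show "dist (mink_grad x) (mink_grad y)
      \<le> (L + (L * R + 1) / \<rho>) / \<rho> * ((1 + R / \<rho>) / \<alpha>) * dist x y"
    by (simp add: dist_norm)
qed

text \<open>The subgradient inequalities at \<open>x\<close> and at \<open>y\<close> trap the
  first-order error between 0 and \<open>inner (mink_grad y - mink_grad x) (y - x)\<close>, which is
  quadratic once \<open>mink_grad\<close> is Lipschitz.\<close>

lemma minkowski_GDERIV: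
  assumes L: "L-lipschitz_on S N" and x: "\<mu> x \<ge> \<alpha>" and "\<alpha> > 0"
  shows "GDERIV \<mu> x :> mink_grad x"
proof -
  \<comment> \<open>Points near \<open>x\<close> may fall below the level \<open>\<alpha>\<close>;
    within distance \<open>\<rho> * (\<alpha> / 2)\<close> they stay nonzero and above
    \<open>\<alpha> / 2\<close>.\<close>
  obtain K where K: "K-lipschitz_on {x. \<mu> x \<ge> \<alpha> / 2} mink_grad"
    using mink_grad_lipschitz[OF L, of "\<alpha> / 2"] \<open>\<alpha> > 0\<close> by auto
  have x0: "x \<noteq> 0" using x \<open>\<alpha> > 0\<close> minkowski_0 by auto
  show ?thesis
  proof (rule GDERIV_if_quadratic_error[where d = "\<rho> * (\<alpha> / 2)" and K = K])
    show "0 < \<rho> * (\<alpha> / 2)" using \<rho>(1) \<open>\<alpha> > 0\<close> by simp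
    fix y assume y: "norm (y - x) < \<rho> * (\<alpha> / 2)"
    define s where "s = (1 / \<mu> x) *\<^sub>R x"
    have s: "s \<in> S" using minkowski_normalize[OF x0] by (simp add: s_def)
    have "\<rho> \<le> norm s"
      using N_dot_ge[OF s] norm_cauchy_schwarz[of "N s" s] s by simp
    then have "\<rho> * \<mu> x \<le> norm x" using minkowski_normalize(1)[OF x0] by (simp add: s_def field_simps)
    moreover have "\<rho> * \<alpha> \<le> \<rho> * \<mu> x" using x \<rho>(1) by simp
    moreover have "0 < \<rho> * \<alpha>" using \<rho>(1) \<open>\<alpha> > 0\<close> by simp
    ultimately have y0: "y \<noteq> 0" using y by auto
    have "\<bar>\<mu> x - \<mu> y\<bar> \<le> norm (y - x) / \<rho>"
      using minkowski_diff_le[OF x0 y0] by (simp add: norm_minus_commute)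
    also have "\<dots> \<le> \<alpha> / 2" using y \<rho>(1) by (simp add: field_simps)
    finally have "\<mu> y \<ge> \<alpha> / 2" using x by linarith
    then have lip: "norm (mink_grad y - mink_grad x) \<le> K * norm (y - x)"
      using lipschitz_onD[OF K, of y x] x \<open>\<alpha> > 0\<close> by (simp add: dist_norm)
    have "0 \<le> \<mu> y - \<mu> x - inner (mink_grad x) (y - x)"
      using minkowski_subgradient[OF x0 y0] by simp
    moreover have "\<mu> y - \<mu> x - inner (mink_grad x) (y - x)
        \<le> inner (mink_grad y - mink_grad x) (y - x)"
      using minkowski_subgradient[OF y0 x0] by (simp add: inner_diff_left inner_diff_right)
    moreover have "\<dots> \<le> norm (mink_grad y - mink_grad x) * norm (y - x)"
      by (rule norm_cauchy_schwarz)
    moreover have "\<dots> \<le> K * norm (y - x) * norm (y - x)"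
      using lip by (rule mult_right_mono) simp
    ultimately show "\<bar>\<mu> y - \<mu> x - inner (mink_grad x) (y - x)\<bar> \<le> K * (norm (y - x))\<^sup>2"
      by (simp add: power2_eq_square mult.assoc)
  qed
qed

text \<open>Differentiating along the ray through \<open>x\<close> gives
  \<open>inner x D = 1\<close>, which keeps \<open>D\<close> away from 0. If \<open>D\<close> did
  not support \<open>V\<close> at \<open>x\<close>, \<open>\<mu>\<close> would exceed 1 at some
  point of \<open>V\<close>.\<close>

lemma minkowski_gradient_at_frontier:
  assumes x: "x \<in> S" and D: "GDERIV \<mu> x :> D"
  shows "1 / R \<le> norm D" and "N x = (1 / norm D) *\<^sub>R D"
proof -
  have mx: "\<mu> x = 1" using minkowski_scaled[OF x, of 1] by simp
  have der: "DERIV (\<lambda>t. \<mu> (x + t *\<^sub>R x)) 0 :> inner x D"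
    using D by (rule GDERIV_imp_directional_DERIV)
  have eq: "\<mu> (x + t *\<^sub>R x) = 1 + t" if "dist t 0 < 1" for t
    using minkowski_scaled[OF x, of "1 + t"] that by (simp add: scaleR_left_distrib dist_real_def)
  have "DERIV (\<lambda>t. 1 + t) 0 :> inner x D"
    using eq by (intro has_field_derivative_transform_within[OF der, of 1]) auto
  moreover have "DERIV (\<lambda>t. 1 + t) (0::real) :> 1" by (auto intro!: derivative_eq_intros)
  ultimately have xD: "inner x D = 1" by (rule DERIV_unique)
  then have "1 \<le> norm x * norm D" using norm_cauchy_schwarz[of x D] by simp
  also have "\<dots> \<le> R * norm D" using R(2)[OF frontier_in_V[OF x]] by (intro mult_right_mono) auto
  finally show DR: "1 / R \<le> norm D" using R(1) by (simp add: field_simps)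
  have D0: "D \<noteq> 0" using xD by auto
  have "inner D (y - x) \<le> 0" if y: "y \<in> V" for y
  proof (rule ccontr)
    assume "\<not> inner D (y - x) \<le> 0"
    then have pos: "0 < inner (y - x) D" by (simp add: inner_commute)
    obtain d where d: "d > 0"
      "\<And>h. 0 < h \<Longrightarrow> h < d \<Longrightarrow> \<mu> (x + 0 *\<^sub>R (y - x)) < \<mu> (x + (0 + h) *\<^sub>R (y - x))"
      using DERIV_pos_inc_right[OF GDERIV_imp_directional_DERIV[OF D] pos] by blast
    \<comment> \<open>The bound 1 keeps the point on the segment inside \<open>V\<close>, and
      \<open>d / 2\<close> keeps it where \<open>\<mu>\<close> has increased.\<close>
    define h where "h = min 1 (d / 2)"
    have h: "0 < h" "h < d" "h \<le> 1" using d(1) by (auto simp: h_def)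
    have "(1 - h) *\<^sub>R x + h *\<^sub>R y \<in> V"
      using h y frontier_in_V[OF x] convex_V by (intro convexD_alt) auto
    then have "\<mu> (x + h *\<^sub>R (y - x)) \<le> 1"
      using minkowski_le_1 by (simp add: algebra_simps)
    then show False using d(2)[OF h(1,2)] mx by simp
  qed
  then show "N x = (1 / norm D) *\<^sub>R D"
    using D0 x by (intro outer_normal_eqI) (auto simp: divide_le_0_iff)
qed

lemma minkowski_C11_iff:
  "(\<exists>L>0. L-lipschitz_on S N) \<longleftrightarrow>
   (\<forall>\<alpha>>0. \<exists>G. (\<forall>x. \<mu> x \<ge> \<alpha> \<longrightarrow> GDERIV \<mu> x :> G x) \<and> (\<exists>K. K-lipschitz_on {x. \<mu> x \<ge> \<alpha>} G))"
proof
  assume "\<exists>L>0. L-lipschitz_on S N"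
  then show "\<forall>\<alpha>>0. \<exists>G. (\<forall>x. \<mu> x \<ge> \<alpha> \<longrightarrow> GDERIV \<mu> x :> G x) \<and> (\<exists>K. K-lipschitz_on {x. \<mu> x \<ge> \<alpha>} G)"
    using minkowski_GDERIV mink_grad_lipschitz by blast
next
  assume "\<forall>\<alpha>>0. \<exists>G. (\<forall>x. \<mu> x \<ge> \<alpha> \<longrightarrow> GDERIV \<mu> x :> G x) \<and> (\<exists>K. K-lipschitz_on {x. \<mu> x \<ge> \<alpha>} G)"
  then obtain G K where G: "\<And>x. \<mu> x \<ge> 1 \<Longrightarrow> GDERIV \<mu> x :> G x"
    and K: "K-lipschitz_on {x. \<mu> x \<ge> 1} G" by (meson zero_less_one)
  have K0: "K \<ge> 0" using lipschitz_on_nonneg[OF K] .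
  have mS: "\<mu> x \<ge> 1" if "x \<in> S" for x using minkowski_scaled[OF that, of 1] by simp
  \<comment> \<open>On the boundary the normal is the normalised gradient, whose norm is at least
    \<open>1 / R\<close>; the summand 1 makes the constant positive even if
    \<open>K = 0\<close>.\<close>
  have "(2 * R * K + 1)-lipschitz_on S N"
  proof (rule lipschitz_onI)
    fix x y assume x: "x \<in> S" and y: "y \<in> S"
    note Gx = minkowski_gradient_at_frontier[OF x G[OF mS[OF x]]]
    note Gy = minkowski_gradient_at_frontier[OF y G[OF mS[OF y]]]
    have "0 < 1 / R" using R(1) by simp
    then have pos: "0 < norm (G x)" "0 < norm (G y)" using Gx(1) Gy(1) by linarith+
    have "dist (N x) (N y)
        \<le> (norm (G x - G y) + norm (G y) / norm (G y) * \<bar>norm (G x) - norm (G y)\<bar>) / norm (G x)"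
      unfolding dist_norm Gx(2) Gy(2) using pos by (rule norm_normalized_diff_le)
    also have "\<dots> \<le> (norm (G x - G y) + norm (G x - G y)) / (1 / R)"
      using pos Gx(1) R(1) norm_triangle_ineq3[of "G x" "G y"] by (intro frac_le) auto
    also have "\<dots> = 2 * R * dist (G x) (G y)" by (simp add: dist_norm)
    also have "\<dots> \<le> 2 * R * (K * dist x y)"
      using lipschitz_onD[OF K, of x y] mS x y R(1) by (intro mult_left_mono) auto
    also have "\<dots> \<le> (2 * R * K + 1) * dist x y" by (simp add: algebra_simps)
    finally show "dist (N x) (N y) \<le> (2 * R * K + 1) * dist x y" .
  qed (use K0 R(1) in simp)
  moreover have "2 * R * K + 1 > 0" using K0 R(1) by (simp add: add_nonneg_pos)
  ultimately show "\<exists>L>0. L-lipschitz_on S N" by blast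
qed

end

theorem theorem2p5:
  fixes V :: "'a::{real_inner, complete_space} set"
  assumes "closed V" and "convex V" and "interior V \<noteq> {}"
    and "c1_hypersurface (frontier V)"
  shows "(\<forall>L>0.
      (L-lipschitz_on (frontier V) (outer_normal V)
        \<longleftrightarrow> (\<forall>r. 0 < r \<and> r < 1 / L \<longrightarrow>
              (\<forall>x\<in>frontier V. \<exists>z. cball z r \<subseteq> V \<and> sphere z r \<inter> frontier V = {x}))) \<and>
      (L-lipschitz_on (frontier V) (outer_normal V)
        \<longleftrightarrow> (\<forall>x\<in>frontier V. \<forall>y\<in>frontier V.
              inner (outer_normal V y) (y - x)
                \<ge> 1 / (2 * L) * (norm (outer_normal V x - outer_normal V y))\<^sup>2)) \<and>
      (L-lipschitz_on (frontier V) (outer_normal V)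
        \<longleftrightarrow> (\<exists>(F :: 'a \<Rightarrow> real) G. convex_on UNIV F \<and>
              (\<forall>x. GDERIV F x :> G x) \<and> L-lipschitz_on UNIV G \<and>
              frontier V = F -` {1} \<and>
              (\<forall>x\<in>frontier V. G x = outer_normal V x))))
    \<and> (bounded V \<and> 0 \<in> interior V \<longrightarrow>
        ((\<exists>L>0. L-lipschitz_on (frontier V) (outer_normal V))
          \<longleftrightarrow> (\<forall>\<alpha>>0. \<exists>G. (\<forall>x. minkowski_functional V x \<ge> \<alpha> \<longrightarrow>
                                GDERIV (minkowski_functional V) x :> G x) \<and>
                           (\<exists>K. K-lipschitz_on {x. minkowski_functional V x \<ge> \<alpha>} G))))"
proof -
  interpret smooth_convex_body V using assms by unfold_locales
  show ?thesis
  proof (rule conjI[OF _ impI])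
    assume *: "bounded V \<and> 0 \<in> interior V"
    obtain \<rho> where \<rho>: "\<rho> > 0" "cball 0 \<rho> \<subseteq> V" using * mem_interior_cball by blast
    obtain R where R: "R > 0" "\<And>y. y \<in> V \<Longrightarrow> norm y \<le> R"
      using * bounded_pos by blast
    interpret bounded_smooth_convex_body V \<rho> R using \<rho> R by unfold_locales
    show "(\<exists>L>0. L-lipschitz_on (frontier V) (outer_normal V))
          \<longleftrightarrow> (\<forall>\<alpha>>0. \<exists>G. (\<forall>x. minkowski_functional V x \<ge> \<alpha> \<longrightarrow>
                                GDERIV (minkowski_functional V) x :> G x) \<and>
                           (\<exists>K. K-lipschitz_on {x. minkowski_functional V x \<ge> \<alpha>} G))"
      by (rule minkowski_C11_iff)
  qed (intro allI impI conjI lipschitz_iff_touching_balls lipschitz_iff_cocoercive lipschitz_iff_extension)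
qed

end
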